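(* For each integer $n\ge 0$, $$\overline{SOME}(40n+31)\equiv 0\pmod 5,$$ $$\overline{SOME}(40n+39)\equiv 0\pmod 5.$$
   Context: An overpartition of a nonnegative integer $n$ is a partition of $n$ in which the first occurrence of each distinct part may be overlined (or not). For $n\ge 0$, $\overline{SOME}(n)$ denotes the sum, over all overpartitions $\lambda$ of $n$, of (the sum of the odd parts of $\lambda$) minus (the sum of the even parts of $\lambda$), where parts are counted with multiplicity and an overlined part counts with its numerical size. *)

theory Defs
  imports "HOL-Library.Multiset" "HOL-Number_Theory.Cong"
begin

text \<open>
  An overpartition is a pair \<open>(M, S)\<close>: \<open>M\<close> is the multiset of the numerical sizes of all parts,
  overlined or not, and \<open>S\<close> is the set of those sizes whose first occurrence is overlined.
\<close>

definition overpartitions :: "nat \<Rightarrow> (nat multiset \<times> nat set) set" where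
  "overpartitions n = {(M, S). 0 \<notin># M \<and> sum_mset M = n \<and> S \<subseteq> set_mset M}"

definition odd_minus_even :: "nat multiset \<Rightarrow> int" where
  "odd_minus_even M = int (sum_mset (filter_mset odd M)) - int (sum_mset (filter_mset even M))"

definition SOME_bar :: "nat \<Rightarrow> int" where
  "SOME_bar n = (\<Sum>(M, S)\<in>overpartitions n. odd_minus_even M)"

lemma size_le_sum_mset:
  fixes M :: "nat multiset"
  assumes "0 \<notin># M"
  shows "size M \<le> sum_mset M"
  using assms by (induction M) auto

text \<open>Finiteness rules out the default value \<open>0\<close> of a sum over an infinite set.\<close>

lemma finite_overpartitions: "finite (overpartitions n)"
proof (rule finite_subset)
  show "overpartitions n \<subseteq> mset ` {xs. set xs \<subseteq> {..n} \<and> length xs \<le> n} \<times> Pow {..n}"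
  proof (clarsimp simp: overpartitions_def)
    fix M :: "nat multiset" and S
    assume M: "0 \<notin># M" "n = sum_mset M" and S: "S \<subseteq> set_mset M"
    obtain xs where xs: "M = mset xs" by (metis ex_mset)
    have le: "x \<le> sum_mset M" if "x \<in># M" for x
      using that by (metis sum_mset.remove le_add1)
    have "set xs \<subseteq> {..sum_mset M}" using le xs by auto
    moreover have "length xs \<le> sum_mset M"
      using size_le_sum_mset[OF M(1)] xs by simp
    ultimately show "M \<in> mset ` {xs. set xs \<subseteq> {..sum_mset M} \<and> length xs \<le> sum_mset M} \<and> S \<subseteq> {..sum_mset M}"
      using xs S le by blast
  qed
  show "finite (mset ` {xs. set xs \<subseteq> {..n} \<and> length xs \<le> n} \<times> Pow {..n})"
    by (intro finite_cartesian_product finite_imageI finite_lists_length_le) auto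
qed

end

theory Submission
  imports Defs "HOL-Computational_Algebra.Formal_Power_Series" "HOL-Computational_Algebra.Polynomial"
begin

text \<open>
  Write \<open>f\<^sub>m\<close> for the product of all \<open>1 - q ^ (m * k)\<close> with \<open>k \<ge> 1\<close>, \<open>\<phi>(q)\<close> for the sum of \<open>q ^ k\<^sup>2\<close> over all
  integers \<open>k\<close>, and \<open>\<psi>(q)\<close> for the sum of \<open>q ^ tri k\<close> over the triangular numbers \<open>tri k = k * (k + 1) / 2\<close>.

  An overpartition amounts to an overpartition into odd parts and one into even parts. If \<open>O\<close> and \<open>E\<close> are
  the generating functions of these and \<open>\<theta> = q d/dq\<close>, then \<open>SOME_bar\<close> has the generating function
  \<open>\<theta>O * E - O * \<theta>E\<close>. Gauss's product for \<open>\<phi>(-q)\<close> shows that \<open>O = \<phi>(q) * E\<close> and \<open>E = 1 / \<phi>(-q\<^sup>2)\<close>, so the derivatives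
  of \<open>E\<close> cancel and the generating function is \<open>\<theta>\<phi>(q) / \<phi>(-q\<^sup>2)\<^sup>2\<close> (\<open>SOME_gf_theta\<close>).

  The coefficients at \<open>8 * n + 7\<close> are extracted by three successive 2-dissections. They rest on
  \<open>\<phi>(q) * \<phi>(-q) = \<phi>(-q\<^sup>2)\<^sup>2\<close>, which turns the denominator into a series in \<open>q\<^sup>2\<close>, and on
  \<open>\<phi>(q)\<^sup>2 = \<phi>(q\<^sup>2)\<^sup>2 + 4 * q * \<psi>(q ^ 4)\<^sup>2\<close>. The result (\<open>SOME_bar_8n_7\<close>) is
  \<open>64 * P * \<psi>(q) ^ 6 / \<phi>(-q) ^ 8\<close>, where \<open>P\<close> is the sum of \<open>(2 * i + 1)\<^sup>2 * q ^ tri i\<close>. Now \<open>\<phi>(-q) = f\<^sub>1\<^sup>2 / f\<^sub>2\<close> and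
  \<open>\<psi>(q) = f\<^sub>2\<^sup>2 / f\<^sub>1\<close>, hence this is \<open>64 * P * f\<^sub>1 ^ 3 * f\<^sub>2 ^ 20 / f\<^sub>1 ^ 25\<close>. Modulo 5 the last two powers are
  series in \<open>q ^ 5\<close>, which do not mix residue classes of exponents.

  It remains to consider \<open>P * f\<^sub>1 ^ 3\<close>. By Jacobi, \<open>f\<^sub>1 ^ 3\<close> is the sum of \<open>(-1) ^ j * (2 * j + 1) * q ^ tri j\<close>, so the
  coefficient at \<open>n\<close> collects \<open>(2 * i + 1)\<^sup>2 * (2 * j + 1)\<close>, up to sign, over \<open>tri i + tri j = n\<close>. This equation means
  \<open>(2 * i + 1)\<^sup>2 + (2 * j + 1)\<^sup>2 = 8 * n + 2\<close>. For \<open>n\<close> congruent to 3 or 4 modulo 5 the right-hand side is \<open>\<plusminus>1\<close>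
  modulo 5; as squares are \<open>0\<close> or \<open>\<plusminus>1\<close>, one of the two must vanish modulo 5. These \<open>n\<close> are the ones with
  \<open>8 * n + 7\<close> of the form \<open>40 * m + 31\<close> or \<open>40 * m + 39\<close>.

  The two classical ingredients, Gauss's product and Jacobi's cube, both come from Rothe's finite
  \<open>q\<close>-binomial theorem (\<open>rothe\<close>), the former by a specialisation and the latter by a derivative, each followed by
  a coefficientwise limit. Gauss's product for \<open>\<psi>\<close> then follows from the dissections (\<open>gauss_psi\<close>).
  All series have integer coefficients, so quotients are stated as products.
\<close>


section \<open>Substitutions and limits of formal power series\<close>

lemma fps_nth_compose_fps_X_power:
  fixes F :: "'a::comm_ring_1 fps"
  assumes "m > 0"
  shows "fps_nth (F oo fps_X ^ m) n = (if m dvd n then fps_nth F (n div m) else 0)"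
proof -
  have "fps_nth (F oo fps_X ^ m) n = (\<Sum>i=0..n. if n = m * i then fps_nth F i else 0)"
    unfolding fps_compose_nth by (intro sum.cong) (auto simp flip: power_mult)
  also have "\<dots> = (\<Sum>i\<in>{0..n} \<inter> {i. n = m * i}. fps_nth F i)"
    by (simp add: sum.If_cases)
  also have "{0..n} \<inter> {i. n = m * i} = (if m dvd n then {n div m} else {})"
    using assms by (auto elim!: dvdE)
  finally show ?thesis by auto
qed

lemma fps_compose_fps_X_power_power:
  fixes F :: "'a::idom fps"
  assumes "m > 0" "k > 0"
  shows "(F oo fps_X ^ m) oo fps_X ^ k = F oo fps_X ^ (m * k)"
proof -
  have "F oo (fps_X ^ m oo fps_X ^ k) = (F oo fps_X ^ m) oo fps_X ^ k"
    by (rule fps_compose_assoc) (use assms in auto)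
  thus ?thesis
    using assms by (simp add: fps_X_power_compose mult.commute flip: power_mult)
qed

lemma fps_nth_compose_uminus_fps_X:
  fixes F :: "'a::comm_ring_1 fps"
  shows "fps_nth (F oo - fps_X) n = (-1) ^ n * fps_nth F n"
  by (simp add: fps_compose_uminus')

lemma fps_compose_even_uminus:
  fixes F :: "'a::comm_ring_1 fps"
  assumes "even m" "m > 0"
  shows "(F oo fps_X ^ m) oo - fps_X = F oo fps_X ^ m"
  using assms by (auto simp: fps_eq_iff fps_nth_compose_uminus_fps_X fps_nth_compose_fps_X_power)

lemma fps_unit_int:
  fixes F :: "int fps"
  assumes "fps_nth F 0 = 1"
  shows "F dvd 1"
proof -
  have "F * fps_right_inverse F 1 = 1"
    by (rule fps_right_inverse) (use assms in auto)
  thus ?thesis by (metis dvd_triv_left)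
qed

text \<open>
  The coefficient of index \<open>n\<close> of a product or of a composition depends on finitely many coefficients
  only, so these operations are continuous for the topology of coefficientwise stabilisation.
\<close>

lemma tendsto_mult_fps:
  fixes F G :: "'a::comm_ring_1 fps"
  assumes "(f \<longlongrightarrow> F) T" "(g \<longlongrightarrow> G) T"
  shows "((\<lambda>x. f x * g x) \<longlongrightarrow> F * G) T"
proof (rule tendsto_fpsI)
  fix n
  have "eventually (\<lambda>x. \<forall>i\<in>{..n}. fps_nth (f x) i = fps_nth F i) T"
       "eventually (\<lambda>x. \<forall>i\<in>{..n}. fps_nth (g x) i = fps_nth G i) T"
    using assms by (auto simp: tendsto_fps_iff eventually_ball_finite_distrib)
  thus "eventually (\<lambda>x. fps_nth (f x * g x) n = fps_nth (F * G) n) T"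
    by eventually_elim (auto simp: fps_mult_nth intro!: sum.cong)
qed

lemma tendsto_diff_fps:
  fixes F G :: "'a::comm_ring_1 fps"
  assumes "(f \<longlongrightarrow> F) T" "(g \<longlongrightarrow> G) T"
  shows "((\<lambda>x. f x - g x) \<longlongrightarrow> F - G) T"
proof (rule tendsto_fpsI)
  fix n
  from assms have "eventually (\<lambda>x. fps_nth (f x) n = fps_nth F n) T"
       "eventually (\<lambda>x. fps_nth (g x) n = fps_nth G n) T"
    by (auto simp: tendsto_fps_iff)
  thus "eventually (\<lambda>x. fps_nth (f x - g x) n = fps_nth (F - G) n) T"
    by eventually_elim auto
qed

lemma tendsto_power_fps:
  fixes F :: "'a::comm_ring_1 fps"
  assumes "(f \<longlongrightarrow> F) T"
  shows "((\<lambda>x. f x ^ k) \<longlongrightarrow> F ^ k) T"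
  by (induction k) (auto intro!: tendsto_mult_fps assms)

lemma tendsto_compose_fps:
  fixes F G :: "'a::comm_ring_1 fps"
  assumes "(f \<longlongrightarrow> F) T"
  shows "((\<lambda>x. f x oo G) \<longlongrightarrow> F oo G) T"
proof (rule tendsto_fpsI)
  fix n
  have "eventually (\<lambda>x. \<forall>i\<in>{..n}. fps_nth (f x) i = fps_nth F i) T"
    using assms by (auto simp: tendsto_fps_iff eventually_ball_finite_distrib)
  thus "eventually (\<lambda>x. fps_nth (f x oo G) n = fps_nth (F oo G) n) T"
    by eventually_elim (auto simp: fps_compose_nth intro!: sum.cong)
qed

lemma fps_X_power_dvdD:
  fixes F :: "'a::comm_ring_1 fps"
  assumes "fps_X ^ d dvd F" "n < d"
  shows "fps_nth F n = 0"
  using assms by (auto elim!: dvdE simp: fps_X_power_mult_nth)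

text \<open>
  Passage from finite identities with an error term to exact identities: an error divisible by ever
  higher powers of the variable vanishes in the limit.
\<close>

lemma LIMSEQ_fps_dvd_unique:
  fixes F G :: "'a::comm_ring_1 fps"
  assumes "f \<longlonglongrightarrow> F" "g \<longlonglongrightarrow> G" "\<And>n. n > 0 \<Longrightarrow> fps_X ^ n dvd f n - g n"
  shows "F = G"
proof (rule fps_ext)
  fix n
  have "eventually (\<lambda>x. fps_nth (f x) n = fps_nth F n) sequentially"
       "eventually (\<lambda>x. fps_nth (g x) n = fps_nth G n) sequentially"
    using assms by (auto simp: tendsto_fps_iff)
  hence "eventually (\<lambda>x. fps_nth F n = fps_nth G n) sequentially"
    using eventually_gt_at_top[of n]
  proof eventually_elim
    case (elim x)
    thus ?case using fps_X_power_dvdD[OF assms(3)[of x], of n] by auto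
  qed
  thus "fps_nth F n = fps_nth G n" by simp
qed

text \<open>
  The series \<open>\<Sum>k. c k * q ^ e k\<close> for an exponent function with \<open>k \<le> e k\<close>; the bound \<open>k \<le> n\<close> is what
  makes the coefficient a finite sum before anything is known about \<open>e\<close>.
\<close>

definition lacunary :: "(nat \<Rightarrow> nat) \<Rightarrow> (nat \<Rightarrow> 'a) \<Rightarrow> 'a::comm_ring_1 fps" where
  "lacunary e c = Abs_fps (\<lambda>n. \<Sum>k | k \<le> n \<and> e k = n. c k)"

lemma LIMSEQ_lacunary:
  fixes c :: "nat \<Rightarrow> 'a::comm_ring_1"
  assumes "\<And>k. k \<le> e k"
  shows "(\<lambda>N. \<Sum>k<N. fps_const (c k) * fps_X ^ e k) \<longlonglongrightarrow> lacunary e c"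
proof (rule tendsto_fpsI)
  fix n
  show "eventually (\<lambda>N. fps_nth (\<Sum>k<N. fps_const (c k) * fps_X ^ e k) n = fps_nth (lacunary e c) n) sequentially"
    using eventually_gt_at_top[of n]
  proof eventually_elim
    case (elim N)
    have "fps_nth (\<Sum>k<N. fps_const (c k) * fps_X ^ e k) n = (\<Sum>k<N. if e k = n then c k else 0)"
      by (auto simp: fps_sum_nth intro!: sum.cong)
    also have "\<dots> = (\<Sum>k\<in>{..<N} \<inter> {k. e k = n}. c k)"
      by (simp add: sum.If_cases)
    also have "{..<N} \<inter> {k. e k = n} = {k. k \<le> n \<and> e k = n}"
      using elim assms by (auto intro: le_less_trans)
    finally show ?case by (simp add: lacunary_def)
  qed
qed

section \<open>Infinite products\<close>

text \<open>
  The limit is coefficientwise. It exists if \<open>k < e k\<close>, because then all factors from index \<open>d\<close> on are 1 up to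
  degree \<open>d\<close>.
\<close>

definition q_prod :: "(nat \<Rightarrow> nat) \<Rightarrow> int fps" where
  "q_prod e = lim (\<lambda>n. \<Prod>k<n. 1 - fps_X ^ e k)"

lemma LIMSEQ_q_prod:
  assumes "\<And>k. k < e k"
  shows "(\<lambda>n. \<Prod>k<n. 1 - fps_X ^ e k) \<longlonglongrightarrow> q_prod e"
proof -
  have nz: "1 - fps_X ^ e k \<noteq> (0 :: int fps)" for k
  proof
    assume "1 - fps_X ^ e k = (0 :: int fps)"
    hence "fps_nth (1 - fps_X ^ e k :: int fps) 0 = 0" by simp
    thus False using assms[of k] by simp
  qed
  have "subdegree (1 - fps_X ^ e k - 1 :: int fps) = e k" for k
    using fps_X_power_subdegree[of "e k"] by simp
  hence "\<exists>P. (\<lambda>n. \<Prod>k\<le>n. 1 - fps_X ^ e k :: int fps) \<longlonglongrightarrow> P"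
    using tendsto_prod_fps[of "\<lambda>k. 1 - fps_X ^ e k :: int fps" id] nz assms 
    by (force intro: less_trans)
  thus ?thesis
    unfolding q_prod_def LIMSEQ_lessThan_iff_atMost[symmetric]
    by (metis convergent_LIMSEQ_iff convergent_def LIMSEQ_lessThan_iff_atMost)
qed

lemma q_prod_nth_0:
  assumes "\<And>k. k < e k"
  shows "fps_nth (q_prod e) 0 = 1"
proof -
  have *: "fps_nth (\<Prod>k<n. 1 - fps_X ^ e k :: int fps) 0 = 1" for n
    using gr_implies_not0[OF assms] by (induction n) auto
  have "eventually (\<lambda>n. fps_nth (\<Prod>k<n. 1 - fps_X ^ e k :: int fps) 0 = fps_nth (q_prod e) 0) sequentially"
    using LIMSEQ_q_prod[of e] assms by (auto simp: tendsto_fps_iff)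
  thus ?thesis by (simp add: *)
qed

definition euler_prod :: "int fps" where "euler_prod = q_prod Suc"
definition odd_prod :: "int fps" where "odd_prod = q_prod (\<lambda>k. 2 * k + 1)"

lemma LIMSEQ_euler_prod: "(\<lambda>n. \<Prod>k<n. 1 - fps_X ^ Suc k) \<longlonglongrightarrow> euler_prod"
  unfolding euler_prod_def by (rule LIMSEQ_q_prod) auto

lemma LIMSEQ_odd_prod: "(\<lambda>n. \<Prod>k<n. 1 - fps_X ^ (2 * k + 1)) \<longlonglongrightarrow> odd_prod"
  unfolding odd_prod_def by (rule LIMSEQ_q_prod) auto

lemma euler_prod_nth_0: "fps_nth euler_prod 0 = 1"
  unfolding euler_prod_def by (rule q_prod_nth_0) auto

lemma odd_prod_nth_0: "fps_nth odd_prod 0 = 1"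
  unfolding odd_prod_def by (rule q_prod_nth_0) auto

lemma q_prod_nonzero: "euler_prod \<noteq> 0" "odd_prod \<noteq> 0"
  using euler_prod_nth_0 odd_prod_nth_0 by force+

lemma filterlim_double: "filterlim (\<lambda>n::nat. 2 * n) sequentially sequentially"
  by (rule filterlim_subseq) (auto simp: strict_mono_def)

text \<open>
  Odd and even exponents of the Euler product are separated: the even ones form the same product
  in \<open>q\<^sup>2\<close>.
\<close>

lemma euler_prod_split: "euler_prod = odd_prod * (euler_prod oo fps_X ^ 2)"
proof (rule LIMSEQ_unique)
  show "(\<lambda>n. (\<Prod>k<2*n. 1 - fps_X ^ Suc k)) \<longlonglongrightarrow> euler_prod"
    by (rule filterlim_compose[OF LIMSEQ_euler_prod filterlim_double])
  have "(\<Prod>k<2*n. 1 - fps_X ^ Suc k) = 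
        (\<Prod>k<n. 1 - fps_X ^ (2 * k + 1)) * ((\<Prod>k<n. 1 - fps_X ^ Suc k) oo fps_X ^ 2 :: int fps)" for n
    by (induction n) (auto simp: fps_compose_mult_distrib fps_compose_sub_distrib 
          fps_X_power_compose algebra_simps simp flip: power_mult power_Suc)
  thus "(\<lambda>n. (\<Prod>k<2*n. 1 - fps_X ^ Suc k)) \<longlonglongrightarrow> odd_prod * (euler_prod oo fps_X ^ 2)"
    by (simp only:) (intro tendsto_mult_fps tendsto_compose_fps LIMSEQ_euler_prod LIMSEQ_odd_prod)
qed

text \<open>
  Factorwise this is \<open>(1 - q ^ m) * (1 + q ^ m) = 1 - q ^ (2 * m)\<close>, because \<open>(- q) ^ m = - q ^ m\<close> for odd \<open>m\<close>.
\<close>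

lemma odd_prod_mult_uminus: "odd_prod * (odd_prod oo - fps_X) = odd_prod oo fps_X ^ 2"
proof (rule LIMSEQ_unique)
  show "(\<lambda>n. (\<Prod>k<n. 1 - fps_X ^ (2 * k + 1)) oo fps_X ^ 2) \<longlonglongrightarrow> (odd_prod oo fps_X ^ 2)"
    by (intro tendsto_compose_fps LIMSEQ_odd_prod)
  have "(\<Prod>k<n. 1 - fps_X ^ (2 * k + 1)) oo fps_X ^ 2 = 
        (\<Prod>k<n. 1 - fps_X ^ (2 * k + 1)) * ((\<Prod>k<n. 1 - fps_X ^ (2 * k + 1)) oo - fps_X :: int fps)" for n
  proof -
    have "(1 - fps_X ^ m) oo fps_X ^ 2 = (1 - fps_X ^ m) * ((1 - fps_X ^ m) oo - fps_X :: int fps)" 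
      if "odd m" for m
    proof -
      have "fps_X ^ m oo - fps_X = - (fps_X ^ m :: int fps)"
        using that by (subst fps_X_power_compose) auto
      moreover have "fps_X ^ m oo fps_X ^ 2 = (fps_X ^ (2 * m) :: int fps)"
        by (subst fps_X_power_compose) (auto simp: power_mult)
      ultimately show ?thesis
        by (simp add: fps_compose_sub_distrib algebra_simps flip: power_add mult_2)
    qed
    thus ?thesis
      by (simp add: fps_compose_prod_distrib del: power_Suc flip: prod.distrib)
  qed
  thus "(\<lambda>n. (\<Prod>k<n. 1 - fps_X ^ (2 * k + 1)) oo fps_X ^ 2) \<longlonglongrightarrow> odd_prod * (odd_prod oo - fps_X)"
    by (simp only:) (intro tendsto_mult_fps tendsto_compose_fps LIMSEQ_odd_prod)
qed


section \<open>Gaussian binomial coefficients\<close>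

fun gauss_binom :: "'a::comm_ring_1 \<Rightarrow> nat \<Rightarrow> nat \<Rightarrow> 'a" where
  "gauss_binom q n 0 = 1"
| "gauss_binom q 0 (Suc k) = 0"
| "gauss_binom q (Suc n) (Suc k) = gauss_binom q n k + q ^ Suc k * gauss_binom q n (Suc k)"

lemma gauss_binom_eq_0: "n < k \<Longrightarrow> gauss_binom q n k = 0"
  by (induction q n k rule: gauss_binom.induct) auto

text \<open>
  Rothe's finite form of the binomial theorem. The induction splits off the factor \<open>y + x\<close> of index 0
  and replaces \<open>x\<close> by \<open>x * q\<close> in the others, which matches the recursion of \<open>gauss_binom\<close>.
\<close>

lemma rothe:
  fixes x y q :: "'a::comm_ring_1"
  shows "(\<Prod>i<n. y + x * q ^ i) = (\<Sum>k\<le>n. gauss_binom q n k * q ^ (k choose 2) * x ^ k * y ^ (n - k))"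
proof (induction n arbitrary: x)
  case 0
  thus ?case by (simp add: binomial_eq_0)
next
  case (Suc n)
  let ?t = "\<lambda>k. gauss_binom q n k * q ^ (k choose 2) * (x * q) ^ k"
  have "(\<Prod>i<Suc n. y + x * q ^ i) = (y + x) * (\<Prod>i<n. y + (x * q) * q ^ i)"
    by (subst prod.lessThan_Suc_shift) (simp add: mult.assoc)
  also have "(\<Prod>i<n. y + (x * q) * q ^ i) = (\<Sum>k\<le>n. ?t k * y ^ (n - k))"
    by (rule Suc.IH)
  also have "(y + x) * \<dots> = (\<Sum>k\<le>n. ?t k * y ^ (Suc n - k)) + (\<Sum>k\<le>n. x * ?t k * y ^ (n - k))"
    by (simp add: distrib_right sum_distrib_left sum.distrib Suc_diff_le mult_ac)
  also have "(\<Sum>k\<le>n. ?t k * y ^ (Suc n - k)) = (\<Sum>k\<le>Suc n. ?t k * y ^ (Suc n - k))"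
    by (simp add: gauss_binom_eq_0)
  also have "\<dots> = y ^ Suc n + (\<Sum>k\<le>n. ?t (Suc k) * y ^ (n - k))"
    by (subst sum.atMost_Suc_shift) (simp add: binomial_eq_0)
  also have "\<dots> + (\<Sum>k\<le>n. x * ?t k * y ^ (n - k)) = 
             y ^ Suc n + (\<Sum>k\<le>n. gauss_binom q (Suc n) (Suc k) * q ^ (Suc k choose 2) * x ^ Suc k * y ^ (n - k))"
    by (simp add: sum.distrib[symmetric] algebra_simps power_add power_mult_distrib numeral_2_eq_2)
  also have "\<dots> = (\<Sum>k\<le>Suc n. gauss_binom q (Suc n) k * q ^ (k choose 2) * x ^ k * y ^ (Suc n - k))"
    by (subst sum.atMost_Suc_shift) (simp add: binomial_eq_0)
  finally show ?case .
qed

text \<open>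
  The quotient formula for Gaussian binomials, cleared of denominators so that it makes sense in
  every commutative ring.
\<close>

lemma gauss_binom_fact:
  fixes q :: "'a::comm_ring_1"
  shows "gauss_binom q (a + b) a * (\<Prod>i<a. 1 - q ^ Suc i) * (\<Prod>i<b. 1 - q ^ Suc i) = (\<Prod>i<a+b. 1 - q ^ Suc i)"
proof (induction "a + b" arbitrary: a b rule: less_induct)
  case less
  show ?case
  proof (cases a)
    case [simp]: (Suc a')
    show ?thesis
    proof (cases b)
      case 0
      have "gauss_binom q a' a' * (\<Prod>i<a'. 1 - q ^ Suc i) = (\<Prod>i<a'. 1 - q ^ Suc i)"
        using less[of a' 0] by simp
      thus ?thesis using 0 by (simp add: gauss_binom_eq_0 mult.assoc[symmetric])
    next
      case [simp]: (Suc b')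
      let ?P = "\<lambda>n. \<Prod>i<n. 1 - q ^ Suc i"
      have "gauss_binom q (a + b) a * ?P a * ?P b = 
              (gauss_binom q (a' + b) a' * ?P a' * ?P b) * (1 - q ^ a) + 
              q ^ a * (1 - q ^ b) * (gauss_binom q (a + b') a * ?P a * ?P b')"
        by (simp add: algebra_simps)
      also have "gauss_binom q (a' + b) a' * ?P a' * ?P b = ?P (a' + b)"
        by (rule less) auto
      also have "gauss_binom q (a + b') a * ?P a * ?P b' = ?P (a + b')"
        by (rule less) auto
      also have "?P (a + b') = ?P (a' + b)"
        by simp
      also have "?P (a' + b) * (1 - q ^ a) + q ^ a * (1 - q ^ b) * ?P (a' + b) = (1 - q ^ (a + b)) * ?P (a' + b)"
        by (simp add: algebra_simps power_add)
      also have "\<dots> = ?P (a + b)"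
        by simp
      finally show ?thesis .
    qed
  qed auto
qed

lemma q_prod_partial_dvd:
  assumes "\<And>k. k < e k" "\<And>k. n \<le> k \<Longrightarrow> d \<le> e k"
  shows "fps_X ^ d dvd q_prod e - (\<Prod>k<n. 1 - fps_X ^ e k)"
proof -
  let ?P = "\<lambda>N. \<Prod>k<N. 1 - fps_X ^ e k :: int fps"
  have *: "fps_X ^ d dvd ?P (n + N) - ?P n" for N
  proof (induction N)
    case (Suc N)
    have "?P (n + Suc N) - ?P n = (?P (n + N) - ?P n) - fps_X ^ e (n + N) * ?P (n + N)"
      by (simp add: algebra_simps)
    thus ?case using Suc assms by (metis dvd_diff dvd_mult2 le_add1 le_imp_power_dvd)
  qed auto
  have "fps_nth (q_prod e - ?P n) i = 0" if "i < d" for i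
  proof -
    have "eventually (\<lambda>N. fps_nth (?P N) i = fps_nth (q_prod e) i) sequentially"
      using LIMSEQ_q_prod[of e] assms by (auto simp: tendsto_fps_iff)
    hence "eventually (\<lambda>N. fps_nth (q_prod e - ?P n) i = 0) sequentially"
      using eventually_ge_at_top[of n]
    proof eventually_elim
      case (elim N)
      from fps_X_power_dvdD[OF *[of "N - n"] that] elim show ?case by simp
    qed
    thus ?thesis by simp
  qed
  hence "q_prod e - ?P n = fps_X ^ d * fps_shift d (q_prod e - ?P n)"
    by (auto simp: fps_eq_iff fps_X_power_mult_nth)
  thus ?thesis by (metis dvd_triv_left)
qed

lemma dvd_cancel_unit_fps:
  fixes F U :: "int fps"
  assumes "fps_nth U 0 = 1" "d dvd U * F"
  shows "d dvd F"
proof -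
  obtain W where "1 = U * W"
    using fps_unit_int[OF assms(1)] by (elim dvdE)
  hence "F = W * (U * F)" by (simp add: mult_ac)
  with assms(2) show ?thesis by (metis dvd_mult)
qed

text \<open>
  As \<open>a\<close> and \<open>b\<close> grow, the Gaussian binomial tends to the inverse of the Euler product. The proof reads this off
  \<open>gauss_binom_fact\<close>: each of the three finite products there agrees with the infinite one in
  all degrees up to \<open>d\<close>, and finite products are units.
\<close>

lemma euler_prod_gauss_binom:
  fixes a b d :: nat
  assumes "d \<le> a" "d \<le> b"
  shows "fps_X ^ Suc d dvd euler_prod * gauss_binom fps_X (a + b) a - 1"
proof -
  let ?P = "\<lambda>N. \<Prod>k<N. 1 - fps_X ^ Suc k :: int fps"
  let ?B = "gauss_binom fps_X (a + b) a :: int fps"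
  have 1: "fps_X ^ Suc d dvd euler_prod - ?P n" if "n \<ge> d" for n
    unfolding euler_prod_def using that by (intro q_prod_partial_dvd) auto
  have 2: "fps_nth (?P n) 0 = 1" for n by (induction n) auto
  have fact: "?B * ?P a * ?P b = ?P (a + b)"
    by (rule gauss_binom_fact)
  have "?P a * (euler_prod * ?B - 1) = ?B * ?P a * (euler_prod - ?P b) + (?P (a + b) - ?P a)"
    unfolding fact[symmetric] by (simp add: algebra_simps)
  also have "?P (a + b) - ?P a = (euler_prod - ?P a) - (euler_prod - ?P (a + b))"
    by simp
  also have "fps_X ^ Suc d dvd ?B * ?P a * (euler_prod - ?P b) + \<dots>"
    using assms by (intro dvd_add dvd_mult dvd_diff 1) auto
  finally show ?thesis
    using 2 dvd_cancel_unit_fps by blast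
qed

lemma gauss_binom_compose:
  fixes G :: "int fps"
  assumes "fps_nth G 0 = 0"
  shows "gauss_binom fps_X n k oo G = gauss_binom G n k"
  using assms
  by (induction "fps_X :: int fps" n k rule: gauss_binom.induct)
     (simp_all add: fps_compose_add_distrib fps_compose_mult_distrib fps_X_power_compose
        del: power_Suc)

lemma euler_prod_gauss_binom_dilate:
  fixes a b d m :: nat
  assumes "d \<le> a" "d \<le> b" "m > 0"
  shows "fps_X ^ (m * Suc d) dvd (euler_prod oo fps_X ^ m) * gauss_binom (fps_X ^ m) (a + b) a - 1"
proof -
  from euler_prod_gauss_binom[OF assms(1,2)] obtain K 
    where K: "euler_prod * gauss_binom fps_X (a + b) a - 1 = fps_X ^ Suc d * K"
    by (elim dvdE)
  have "(euler_prod * gauss_binom fps_X (a + b) a - 1) oo fps_X ^ m = fps_X ^ (m * Suc d) * (K oo fps_X ^ m)"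
    unfolding K using assms
    by (simp add: fps_compose_mult_distrib fps_X_power_compose del: power_Suc mult_Suc_right flip: power_mult)
  also have "(euler_prod * gauss_binom fps_X (a + b) a - 1) oo fps_X ^ m = 
     (euler_prod oo fps_X ^ m) * gauss_binom (fps_X ^ m) (a + b) a - 1"
    using assms by (simp add: fps_compose_sub_distrib fps_compose_mult_distrib gauss_binom_compose)
  finally show ?thesis by simp
qed


section \<open>Theta series and the product for \<open>theta_neg\<close>\<close>

text \<open>
  \<open>theta\<close> is \<open>\<phi>(q)\<close>, the sum of \<open>q ^ k\<^sup>2\<close> over all integers \<open>k\<close>; the terms of \<open>k\<close> and \<open>- k\<close> are merged,
  whence the coefficient 2. Then \<open>theta_neg\<close> is \<open>\<phi>(-q)\<close>.
\<close>

definition theta :: "int fps" where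
  "theta = lacunary (\<lambda>k. k\<^sup>2) (\<lambda>k. if k = 0 then 1 else 2)"

abbreviation theta_neg :: "int fps" where
  "theta_neg \<equiv> theta oo - fps_X"

definition tri :: "nat \<Rightarrow> nat" where
  "tri k = k * (k + 1) div 2"

text \<open>
  Gauss's triangular series \<open>\<psi>(q)\<close>.
\<close>

definition psi :: "int fps" where
  "psi = lacunary tri (\<lambda>_. 1)"

text \<open>
  The right-hand side of Jacobi's identity for the cube of the Euler product, see \<open>euler_prod_cube\<close>.
\<close>

definition jacobi_cube :: "int fps" where
  "jacobi_cube = lacunary tri (\<lambda>k. (-1) ^ k * (2 * int k + 1))"

lemma two_tri: "2 * tri k = k * (k + 1)"
  unfolding tri_def by simp

lemma tri_ge: "k \<le> tri k"
proof -
  have "2 * k \<le> k * (k + 1)"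
    by (cases k) auto
  thus ?thesis using two_tri[of k] by linarith
qed

lemma two_choose_2: "2 * (k choose 2) = k * (k - 1)"
  by (cases k) (simp_all add: choose_two)

lemma power2_ge_nat: "(k::nat) \<le> k\<^sup>2"
  by (cases k) (auto simp: power2_eq_square)

lemma sum_centred_even:
  fixes h :: "nat \<Rightarrow> 'a::comm_monoid_add"
  shows "(\<Sum>j\<le>2*n. h j) = h n + (\<Sum>k<n. h (n + Suc k) + h (n - Suc k))"
proof -
  have "(\<Sum>j\<le>2*n. h j) = (\<Sum>j<n. h j) + (h n + (\<Sum>k<n. h (n + Suc k)))"
  proof -
    have "{..2*n} = {..<n} \<union> (insert n ((\<lambda>k. n + Suc k) ` {..<n}))"
    proof (intro equalityI subsetI)
      fix x assume "x \<in> {..2*n}"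
      moreover have "x = n + Suc (x - Suc n)" if "x > n" using that by simp
      ultimately show "x \<in> {..<n} \<union> (insert n ((\<lambda>k. n + Suc k) ` {..<n}))"
        by (cases x n rule: linorder_cases) (auto intro!: image_eqI[of _ _ "x - Suc n"])
    qed auto
    moreover have "n \<notin> (\<lambda>k. n + Suc k) ` {..<n}"
      by auto
    ultimately show ?thesis
      by (simp only:, subst sum.union_disjoint) (auto simp: sum.reindex inj_on_def simp del: add_Suc_right)
  qed
  also have "(\<Sum>j<n. h j) = (\<Sum>k<n. h (n - Suc k))"
    by (rule sum.nat_diff_reindex [symmetric])
  finally show ?thesis by (simp add: sum.distrib algebra_simps)
qed

lemma sum_centred_odd:
  fixes h :: "nat \<Rightarrow> 'a::comm_monoid_add"
  shows "(\<Sum>j\<le>2*n+1. h j) = (\<Sum>k<Suc n. h (n + 1 + k) + h (n - k))"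
proof -
  have "(\<Sum>j\<le>2*n+1. h j) = (\<Sum>j<Suc n. h j) + (\<Sum>k<Suc n. h (n + 1 + k))"
  proof -
    have "{..2*n+1} = {..<Suc n} \<union> ((\<lambda>k. n + 1 + k) ` {..<Suc n})"
    proof (intro equalityI subsetI)
      fix x assume "x \<in> {..2*n+1}"
      thus "x \<in> {..<Suc n} \<union> ((\<lambda>k. n + 1 + k) ` {..<Suc n})"
        by (cases "x < Suc n") (auto intro!: image_eqI[of _ _ "x - Suc n"])
    qed auto
    thus ?thesis
      by (simp only:, subst sum.union_disjoint) (auto simp: sum.reindex inj_on_def)
  qed
  also have "(\<Sum>j<Suc n. h j) = (\<Sum>k<Suc n. h (n - k))"
    using sum.nat_diff_reindex[of h "Suc n"] by simp
  finally show ?thesis by (simp only: sum.distrib add.commute)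
qed

lemma prod_lessThan_double:
  fixes h :: "nat \<Rightarrow> 'a::comm_monoid_mult"
  shows "(\<Prod>i<2*n. h i) = (\<Prod>k<n. h (n + k) * h (n - Suc k))"
proof -
  have "(\<Prod>i<2*n. h i) = (\<Prod>i<n. h i) * (\<Prod>k<n. h (n + k))"
  proof -
    have "{..<2*n} = {..<n} \<union> ((\<lambda>k. n + k) ` {..<n})"
    proof (intro equalityI subsetI)
      fix x assume "x \<in> {..<2*n}"
      thus "x \<in> {..<n} \<union> ((\<lambda>k. n + k) ` {..<n})"
        by (cases "x < n") (auto intro!: image_eqI[of _ _ "x - n"])
    qed auto
    thus ?thesis
      by (simp only:, subst prod.union_disjoint) (auto simp: prod.reindex inj_on_def)
  qed
  also have "(\<Prod>j<n. h j) = (\<Prod>k<n. h (n - Suc k))"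
    by (rule prod.nat_diff_reindex [symmetric])
  finally show ?thesis by (simp add: prod.distrib mult.commute)
qed

text \<open>
  Rothe's identity in the variable \<open>q\<^sup>2\<close> with \<open>2 * n\<close> factors, at \<open>y = q ^ (2 * n - 1)\<close> and \<open>x = -1\<close>. Pairing the factors
  of index \<open>n + k\<close> and \<open>n - 1 - k\<close> gives \<open>(1 - q ^ (2 * k + 1))\<^sup>2\<close> up to sign and a power of \<open>q\<close>; the term of
  index \<open>n \<plusminus> k\<close> gives \<open>q ^ k\<^sup>2\<close> up to the same factor, called \<open>c\<close> in the proof.
\<close>

lemma odd_prod_finite_gauss:
  fixes n :: nat
  defines "B \<equiv> gauss_binom (fps_X ^ 2 :: int fps) (2 * n)"
  shows "(\<Prod>k<n. 1 - fps_X ^ (2 * k + 1)) ^ 2 = 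
         B n + (\<Sum>k<n. (-1) ^ Suc k * fps_X ^ (Suc k)\<^sup>2 * (B (n + Suc k) + B (n - Suc k)))"
proof (cases "n = 0")
  case True
  thus ?thesis by (simp add: B_def)
next
  case n: False
  (* The factor common to all terms, by which the identity is divided at the end. *)
  define c :: "int fps" where "c = (-1) ^ n * fps_X ^ (n * (2 * n - 1) + n * (n - 1))"
  have *: "(fps_X ^ (2 * n - 1) + (-1) * (fps_X ^ 2) ^ (n + k)) * 
        (fps_X ^ (2 * n - 1) + (-1) * (fps_X ^ 2) ^ (n - Suc k)) =
        ((-1) * fps_X ^ (2 * n - 1) * fps_X ^ (2 * (n - Suc k))) * ((1 - fps_X ^ (2 * k + 1)) ^ 2 :: int fps)" if kn: "k < n" for k
  proof -
    obtain r where n: "n = Suc k + r" using less_imp_Suc_add[OF kn] by auto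
    define Y Z :: "int fps" where "Y = fps_X ^ (2 * r)" and "Z = fps_X ^ (2 * k + 1)"
    have e: "2 * n - 1 = 2 * r + (2 * k + 1)" "2 * (n + k) = 2 * r + (2 * k + 1) + (2 * k + 1)" "n - Suc k = r"
      by (simp_all add: n)
    have "fps_X ^ (2 * n - 1) = Y * Z" "(fps_X ^ 2) ^ (n + k) = Y * Z * Z" 
         "(fps_X ^ 2) ^ (n - Suc k) = Y" "fps_X ^ (2 * (n - Suc k)) = Y"
      unfolding e power_mult[symmetric] Y_def Z_def by (simp_all only: power_add)
    thus ?thesis
      unfolding Z_def[symmetric] by (simp add: algebra_simps power2_eq_square)
  qed
  have "(\<Prod>i<2*n. fps_X ^ (2 * n - 1) + (-1) * (fps_X ^ 2) ^ i) =
     (\<Prod>k<n. (-1) * fps_X ^ (2 * n - 1) * fps_X ^ (2 * (n - Suc k))) * (\<Prod>k<n. 1 - fps_X ^ (2 * k + 1) :: int fps) ^ 2"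
    unfolding prod_lessThan_double prod_power_distrib prod.distrib[symmetric]
    by (intro prod.cong refl *) auto
  also have "(\<Prod>k<n. (-1) * fps_X ^ (2 * n - 1) * fps_X ^ (2 * (n - Suc k))) = 
      ((-1) * fps_X ^ (2 * n - 1)) ^ n * (\<Prod>k<n. fps_X ^ (2 * k) :: int fps)"
    using prod.nat_diff_reindex[of "\<lambda>k. fps_X ^ (2 * k) :: int fps" n]
    by (simp only: prod.distrib prod_constant card_lessThan power_mult_distrib)
  also have "(\<Prod>k<n. fps_X ^ (2 * k) :: int fps) = fps_X ^ (n * (n - 1))"
  proof -
    have "(\<Sum>k<n. 2 * k) = n * (n - 1)"
    proof (induction n)
      case (Suc n)
      thus ?case by (cases n) simp_all
    qed auto
    thus ?thesis by (simp flip: power_sum)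
  qed
  also have "((-1) * fps_X ^ (2 * n - 1)) ^ n * fps_X ^ (n * (n - 1)) = c"
    unfolding c_def power_mult_distrib power_add power_mult[symmetric] by (simp add: mult_ac)
  finally have 1: "c * (\<Prod>k<n. 1 - fps_X ^ (2 * k + 1)) ^ 2 = (\<Prod>i<2*n. fps_X ^ (2 * n - 1) + (-1) * (fps_X ^ 2) ^ i)" 
    by simp

  define h where "h = (\<lambda>k. B k * (fps_X ^ 2) ^ (k choose 2) * (-1) ^ k * (fps_X ^ (2 * n - 1)) ^ (2 * n - k))"
  have h: "h = (\<lambda>k. (-1) ^ k * fps_X ^ (k * (k - 1) + (2 * n - 1) * (2 * n - k)) * B k)"
    by (rule ext) (simp add: h_def two_choose_2 mult_ac flip: power_mult power_add)
  have h1: "h (n + k) = c * ((-1) ^ k * fps_X ^ k\<^sup>2 * B (n + k))" if kn: "k \<le> n" for k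
  proof -
    obtain r where nr: "n = k + r" using kn by (metis le_iff_add)
    have "(n + k) * (n + k - 1) + (2 * n - 1) * (2 * n - (n + k)) = n * (2 * n - 1) + n * (n - 1) + k\<^sup>2"
      using n unfolding nr by (cases r; cases k) (auto simp: algebra_simps power2_eq_square)
    note E = this
    show ?thesis unfolding h c_def E by (simp only: power_add mult_ac)
  qed
  have h2: "h (n - k) = c * ((-1) ^ k * fps_X ^ k\<^sup>2 * B (n - k))" if kn: "k \<le> n" for k
  proof -
    obtain r where nr: "n = k + r" using kn by (metis le_iff_add)
    have "(n - k) * (n - k - 1) + (2 * n - 1) * (2 * n - (n - k)) = n * (2 * n - 1) + n * (n - 1) + k\<^sup>2"
      using n unfolding nr by (cases r; cases k) (auto simp: algebra_simps power2_eq_square)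
    note E = this
    have S: "(-1) ^ (n - k) = ((-1) ^ n * (-1) ^ k :: int fps)"
      by (cases "even k") (simp_all add: nr power_add)
    show ?thesis unfolding h c_def E S by (simp only: power_add mult_ac)
  qed
  have "c * (\<Prod>k<n. 1 - fps_X ^ (2 * k + 1)) ^ 2 = (\<Sum>j\<le>2*n. h j)"
    unfolding 1 rothe h_def B_def ..
  also have "\<dots> = h n + (\<Sum>k<n. h (n + Suc k) + h (n - Suc k))"
    by (rule sum_centred_even)
  also have "\<dots> = c * (B n + (\<Sum>k<n. (-1) ^ Suc k * fps_X ^ (Suc k)\<^sup>2 * (B (n + Suc k) + B (n - Suc k))))"
  proof -
    have "h (n + Suc k) + h (n - Suc k) = c * ((-1) ^ Suc k * fps_X ^ (Suc k)\<^sup>2 * (B (n + Suc k) + B (n - Suc k)))"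
      if "k < n" for k
      using h1[of "Suc k"] h2[of "Suc k"] that by (simp only: distrib_left mult.assoc Suc_le_eq)
    moreover have "h n = c * B n"
      using h1[of 0] by simp
    ultimately show ?thesis
      by (simp add: sum_distrib_left distrib_left del: add_Suc_right power_Suc)
  qed
  finally show ?thesis by (simp add: c_def)
qed

text \<open>
  Limit of \<open>odd_prod_finite_gauss\<close>. After multiplication by the Euler product in \<open>q\<^sup>2\<close> the Gaussian binomials
  become 1 up to \<open>q ^ (2 * (n - k + 1))\<close>; together with the factor \<open>q ^ k\<^sup>2\<close> the error has order at
  least \<open>2 * n + 1\<close>, since \<open>2 * k \<le> k\<^sup>2 + 1\<close>.
\<close>

lemma gauss_theta_neg: "theta_neg = odd_prod ^ 2 * (euler_prod oo fps_X ^ 2)"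
proof (rule LIMSEQ_fps_dvd_unique [symmetric])
  let ?F = "euler_prod oo fps_X ^ 2" and ?O = "\<lambda>n. \<Prod>k<n. 1 - fps_X ^ (2 * k + 1) :: int fps"
  let ?S = "\<lambda>n. \<Sum>k<Suc n. fps_const (if k = 0 then 1 else 2) * fps_X ^ k\<^sup>2 :: int fps"
  show "(\<lambda>n. ?O n ^ 2 * ?F) \<longlonglongrightarrow> odd_prod ^ 2 * ?F"
    by (intro tendsto_mult_fps tendsto_power_fps LIMSEQ_odd_prod tendsto_const)
  show "(\<lambda>n. ?S n oo - fps_X) \<longlonglongrightarrow> theta_neg"
    unfolding theta_def by (intro tendsto_compose_fps LIMSEQ_Suc LIMSEQ_lacunary power2_ge_nat)
  fix n :: nat
  define B where "B = gauss_binom (fps_X ^ 2 :: int fps) (2 * n)"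
  have B: "fps_X ^ Suc (2*n) dvd fps_X ^ k\<^sup>2 * (?F * B j - 1)" if "j = n + k \<or> j = n - k" "k \<le> n" for j k
  proof -
    have "fps_X ^ (2 * Suc (n - k)) dvd (?F * B j - 1)"
      using euler_prod_gauss_binom_dilate[of "n - k" j "2 * n - j" 2] that by (auto simp: B_def simp flip: mult_2)
    hence "fps_X ^ (k\<^sup>2 + 2 * Suc (n - k)) dvd fps_X ^ k\<^sup>2 * (?F * B j - 1)"
      by (auto simp: power_add intro: mult_dvd_mono)
    moreover have "Suc (2 * n) \<le> k\<^sup>2 + 2 * Suc (n - k)"
    proof -
      have "2 * k \<le> k\<^sup>2 + 1"
        by (cases k) (auto simp: power2_eq_square)
      thus ?thesis using that by simp
    qed
    ultimately show ?thesis by (meson dvd_trans le_imp_power_dvd)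
  qed
  have "?S n oo - fps_X = 1 + (\<Sum>k<n. (-1) ^ Suc k * fps_X ^ (Suc k)\<^sup>2 * 2)"
  proof -
    have "(fps_const 2 * fps_X ^ m :: int fps) oo - fps_X = (-1) ^ m * fps_X ^ m * 2" for m
      by (simp add: fps_compose_mult_distrib fps_X_power_compose numeral_fps_const power_minus[of fps_X] mult_ac)
    moreover have "(-1) ^ (Suc k)\<^sup>2 = ((-1) ^ Suc k :: int fps)" for k
      by (simp add: minus_one_power_iff)
    ultimately show ?thesis 
      by (subst sum.lessThan_Suc_shift) (simp add: fps_compose_add_distrib fps_compose_sum_distrib)
  qed
  hence "?O n ^ 2 * ?F - (?S n oo - fps_X) = (?F * B n - 1) + (\<Sum>k<n. (-1) ^ Suc k * 
           (fps_X ^ (Suc k)\<^sup>2 * (?F * B (n + Suc k) - 1) + fps_X ^ (Suc k)\<^sup>2 * (?F * B (n - Suc k) - 1)))"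
    unfolding odd_prod_finite_gauss B_def[symmetric]
    by (simp add: algebra_simps sum_distrib_left sum_distrib_right sum.distrib sum_subtractf sum_negf)
  also have "fps_X ^ Suc (2*n) dvd \<dots>"
    using B[of n 0] by (intro dvd_add dvd_sum dvd_mult B) auto
  finally show "fps_X ^ n dvd ?O n ^ 2 * ?F - (?S n oo - fps_X)"
    by (rule power_le_dvd) simp
qed


section \<open>The cube of the Euler product\<close>

lemma gauss_binom_pCons:
  "gauss_binom [:q:] n k = [:gauss_binom q n k:]"
  by (induction q n k rule: gauss_binom.induct) (simp_all add: pCons_one poly_const_pow del: power_Suc)

lemma pderiv_sum: "pderiv (sum f A) = (\<Sum>x\<in>A. pderiv (f x))"
  by (induction A rule: infinite_finite_induct) (simp_all add: pderiv_add)

text \<open>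
  At a zero of one factor only the term that differentiates this factor survives in the derivative of
  the product. So the derivative at \<open>z = 1\<close> of Rothe's identity, with \<open>x * z\<close> in place of \<open>x\<close>,
  yields a formula for the product of the other factors.
\<close>

lemma rothe_derivative:
  fixes x y q :: "int fps"
  assumes "a < n" "y + x * q ^ a = 0"
  shows "x * q ^ a * (\<Prod>i\<in>{..<n} - {a}. y + x * q ^ i) = 
         (\<Sum>k\<le>n. of_nat k * (gauss_binom q n k * q ^ (k choose 2) * x ^ k * y ^ (n - k)))"
proof -
  let ?c = "\<lambda>k. gauss_binom q n k * q ^ (k choose 2) * x ^ k * y ^ (n - k)"
  have y: "[:y:] + [:0, x:] * [:q:] ^ i = [:y, x * q ^ i:]" for i
    by (simp add: poly_const_pow mult.commute)
  have x: "[:0, x:] ^ k = monom (x ^ k) k" for k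
    by (simp add: monom_altdef flip: smult_power)
  have "(\<Prod>i<n. [:y, x * q ^ i:]) = (\<Sum>k\<le>n. monom (?c k) k)"
    using rothe[of "[:y:]" "[:0, x:]" "[:q:]" n]
    unfolding y x by (simp add: gauss_binom_pCons poly_const_pow smult_monom mult_ac)
  hence "poly (pderiv (\<Prod>i<n. [:y, x * q ^ i:])) 1 = poly (pderiv (\<Sum>k\<le>n. monom (?c k) k)) 1"
    by simp
  also have "\<dots> = (\<Sum>k\<le>n. of_nat k * ?c k)"
    by (simp add: pderiv_sum poly_sum pderiv_monom poly_monom)
  also have "(\<Prod>i<n. [:y, x * q ^ i:]) = [:y, x * q ^ a:] * (\<Prod>i\<in>{..<n} - {a}. [:y, x * q ^ i:])"
    using assms by (subst prod.remove[of _ a]) auto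
  also have "poly (pderiv \<dots>) 1 = x * q ^ a * (\<Prod>i\<in>{..<n} - {a}. y + x * q ^ i)"
    by (simp only: pderiv_mult poly_add poly_mult) (use assms in \<open>simp add: poly_prod pderiv_pCons\<close>)
  finally show ?thesis .
qed

text \<open>
  The case \<open>y = q ^ n\<close>, \<open>x = -1\<close> of \<open>rothe_derivative\<close> with \<open>2 * n + 1\<close> factors: the middle one vanishes, and those on its
  two sides produce the square of the partial Euler product. The terms of index \<open>n + 1 + k\<close> and
  \<open>n - k\<close> carry the same power \<open>q ^ tri k\<close> and opposite signs.
\<close>

lemma euler_prod_cube_finite:
  fixes n :: nat
  defines "B \<equiv> gauss_binom (fps_X :: int fps) (2 * n + 1)"
  shows "(\<Prod>k<n. 1 - fps_X ^ Suc k) ^ 2 = 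
         (\<Sum>k<Suc n. (-1) ^ k * fps_X ^ tri k * (of_nat (n + 1 + k) * B (n + 1 + k) - of_nat (n - k) * B (n - k)))"
proof -
  define c :: "int fps" where "c = - ((-1) ^ n * fps_X ^ (n + n * n + (n choose 2)))"
  let ?P = "\<Prod>k<n. 1 - fps_X ^ Suc k :: int fps"
  let ?f = "\<lambda>i. fps_X ^ n + (-1) * fps_X ^ i :: int fps"
  have "{..<2*n+1} - {n} = {..<n} \<union> (\<lambda>k. n + Suc k) ` {..<n}"
  proof (intro equalityI subsetI)
    fix x assume "x \<in> {..<2*n+1} - {n}"
    hence "x < n \<or> (x = n + Suc (x - Suc n) \<and> x - Suc n < n)" by auto
    thus "x \<in> {..<n} \<union> (\<lambda>k. n + Suc k) ` {..<n}" by blast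
  qed auto
  note D = this
  have "(\<Prod>i\<in>{..<2*n+1} - {n}. ?f i) = (\<Prod>i<n. ?f i) * (\<Prod>k<n. ?f (n + Suc k))"
    unfolding D by (subst prod.union_disjoint) (auto simp: prod.reindex inj_on_def)
  also have "(\<Prod>k<n. ?f (n + Suc k)) = fps_X ^ (n * n) * ?P"
  proof -
    have "?f (n + Suc k) = fps_X ^ n * (1 - fps_X ^ Suc k)" for k
      by (simp add: algebra_simps power_add)
    thus ?thesis by (simp only: prod.distrib prod_constant card_lessThan power_mult)
  qed
  also have "(\<Prod>i<n. ?f i) = (\<Prod>k<n. ?f (n - Suc k))"
    by (rule prod.nat_diff_reindex [symmetric])
  also have "\<dots> = (\<Prod>k<n. (-1) * fps_X ^ (n - Suc k) * (1 - fps_X ^ Suc k))"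
  proof (intro prod.cong refl)
    fix k assume "k \<in> {..<n}"
    hence "n = (n - Suc k) + Suc k" by simp
    hence "fps_X ^ n = (fps_X ^ (n - Suc k) * fps_X ^ Suc k :: int fps)"
      by (metis power_add)
    thus "?f (n - Suc k) = (-1) * fps_X ^ (n - Suc k) * (1 - fps_X ^ Suc k)"
      by (simp add: algebra_simps)
  qed
  also have "\<dots> = (-1) ^ n * (\<Prod>k<n. fps_X ^ (n - Suc k)) * ?P"
    by (simp only: prod.distrib prod_constant card_lessThan)
  also have "(\<Prod>k<n. fps_X ^ (n - Suc k)) = (\<Prod>k<n. fps_X ^ k :: int fps)"
    by (rule prod.nat_diff_reindex)
  also have "\<dots> = fps_X ^ (n choose 2)"
  proof -
    have "(\<Sum>k<n. k) = n choose 2"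
      by (induction n) (auto simp: numeral_2_eq_2)
    thus ?thesis by (simp flip: power_sum)
  qed
  finally have "c * ?P ^ 2 = - 1 * fps_X ^ n * (\<Prod>i\<in>{..<2*n+1} - {n}. ?f i)"
    by (simp add: c_def power_add power2_eq_square mult_ac)

  define h where "h = (\<lambda>k. of_nat k * (B k * fps_X ^ (k choose 2) * (-1) ^ k * (fps_X ^ n) ^ (2 * n + 1 - k)))"
  have h: "h = (\<lambda>k. (-1) ^ k * fps_X ^ ((k choose 2) + n * (2 * n + 1 - k)) * (of_nat k * B k))"
    by (rule ext) (simp add: h_def power_add power_mult mult_ac)
  have h1: "h (n + 1 + k) = c * ((-1) ^ k * fps_X ^ tri k * (of_nat (n + 1 + k) * B (n + 1 + k)))" if kn: "k \<le> n" for k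
  proof -
    obtain r where nr: "n = k + r" using kn by (metis le_iff_add)
    have "2 * ((n + 1 + k choose 2) + n * (2 * n + 1 - (n + 1 + k))) = 2 * (n + n * n + (n choose 2) + tri k)"
      unfolding distrib_left two_choose_2 two_tri
      unfolding nr by (cases r; cases k) (auto simp: algebra_simps)
    hence E: "(n + 1 + k choose 2) + n * (2 * n + 1 - (n + 1 + k)) = n + n * n + (n choose 2) + tri k"
      by simp
    have S: "(-1) ^ (n + 1 + k) = (- ((-1) ^ n * (-1) ^ k) :: int fps)"
      by (simp add: power_add)
    show ?thesis unfolding h c_def E S unfolding power_add mult_minus_left by (simp only: mult_ac)
  qed
  have h2: "h (n - k) = - (c * ((-1) ^ k * fps_X ^ tri k * (of_nat (n - k) * B (n - k))))" if kn: "k \<le> n" for k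
  proof -
    obtain r where nr: "n = k + r" using kn by (metis le_iff_add)
    have "2 * ((n - k choose 2) + n * (2 * n + 1 - (n - k))) = 2 * (n + n * n + (n choose 2) + tri k)"
      unfolding distrib_left two_choose_2 two_tri
      unfolding nr by (cases r; cases k) (auto simp: algebra_simps)
    hence E: "(n - k choose 2) + n * (2 * n + 1 - (n - k)) = n + n * n + (n choose 2) + tri k"
      by simp
    have S: "(-1) ^ (n - k) = ((-1) ^ n * (-1) ^ k :: int fps)"
      by (cases "even k") (simp_all add: nr power_add)
    show ?thesis unfolding h c_def E S unfolding power_add mult_minus_left minus_minus by (simp only: mult_ac)
  qed
  have "c * ?P ^ 2 = - 1 * fps_X ^ n * (\<Prod>i\<in>{..<2*n+1} - {n}. ?f i)"
    by fact
  also have "\<dots> = (\<Sum>j\<le>2*n+1. h j)"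
    unfolding h_def B_def by (rule rothe_derivative) auto
  also have "\<dots> = (\<Sum>k<Suc n. h (n + 1 + k) + h (n - k))"
    by (rule sum_centred_odd)
  also have "\<dots> = c * (\<Sum>k<Suc n. (-1) ^ k * fps_X ^ tri k * (of_nat (n + 1 + k) * B (n + 1 + k) - of_nat (n - k) * B (n - k)))"
    unfolding sum_distrib_left
  proof (intro sum.cong refl)
    fix k assume "k \<in> {..<Suc n}"
    hence k: "k \<le> n" by auto
    show "h (n + 1 + k) + h (n - k) = c * ((-1) ^ k * fps_X ^ tri k * (of_nat (n + 1 + k) * B (n + 1 + k) - of_nat (n - k) * B (n - k)))"
      unfolding h1[OF k] h2[OF k] by (simp only: right_diff_distrib add_uminus_conv_diff)
  qed
  finally show ?thesis by (simp add: c_def)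
qed

text \<open>
  Jacobi's identity, as the limit of \<open>euler_prod_cube_finite\<close>: in the limit both binomials are
  the inverse of the Euler product, and \<open>(n + 1 + k) - (n - k) = 2 * k + 1\<close>.
\<close>

lemma euler_prod_cube: "euler_prod ^ 3 = jacobi_cube"
proof (rule LIMSEQ_fps_dvd_unique)
  let ?P = "\<lambda>n. \<Prod>k<n. 1 - fps_X ^ Suc k :: int fps"
  let ?S = "\<lambda>n. \<Sum>k<Suc n. fps_const ((-1) ^ k * (2 * int k + 1)) * fps_X ^ tri k"
  have "(\<lambda>n. euler_prod * ?P n ^ 2) \<longlonglongrightarrow> euler_prod * euler_prod ^ 2"
    by (intro tendsto_mult_fps tendsto_power_fps LIMSEQ_euler_prod tendsto_const)
  thus "(\<lambda>n. euler_prod * ?P n ^ 2) \<longlonglongrightarrow> euler_prod ^ 3"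
    by (simp add: power3_eq_cube power2_eq_square mult_ac)
  show "?S \<longlonglongrightarrow> jacobi_cube"
    unfolding jacobi_cube_def by (intro LIMSEQ_Suc LIMSEQ_lacunary tri_ge)
  fix n :: nat
  define B where "B = gauss_binom (fps_X :: int fps) (2 * n + 1)"
  have B: "fps_X ^ Suc n dvd fps_X ^ tri k * (euler_prod * B j - 1)" if "j = n + 1 + k \<or> j = n - k" "k \<le> n" for j k
  proof -
    have "j + (2 * n + 1 - j) = 2 * n + 1" "n - k \<le> j" "n - k \<le> 2 * n + 1 - j"
      using that by auto
    hence "fps_X ^ (Suc (n - k)) dvd (euler_prod * B j - 1)"
      using euler_prod_gauss_binom[of "n - k" j "2 * n + 1 - j"] by (simp only: B_def)
    hence "fps_X ^ (tri k + Suc (n - k)) dvd fps_X ^ tri k * (euler_prod * B j - 1)"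
      unfolding power_add by (rule mult_dvd_mono[OF dvd_refl])
    moreover have "Suc n \<le> tri k + Suc (n - k)"
      using that tri_ge[of k] by simp
    ultimately show ?thesis by (meson power_le_dvd)
  qed
  have "euler_prod * ?P n ^ 2 - ?S n = (\<Sum>k<Suc n. (-1) ^ k * 
     (of_nat (n + 1 + k) * (fps_X ^ tri k * (euler_prod * B (n + 1 + k) - 1)) - 
      of_nat (n - k) * (fps_X ^ tri k * (euler_prod * B (n - k) - 1))))"
    unfolding euler_prod_cube_finite B_def[symmetric] sum_distrib_left sum_subtractf[symmetric]
  proof (intro sum.cong refl)
    fix k assume "k \<in> {..<Suc n}"
    hence "of_nat (n + 1 + k) - of_nat (n - k) = (fps_const (2 * int k + 1) :: int fps)"
      by (simp add: of_nat_diff fps_of_nat[symmetric] numeral_fps_const add.commute)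
    hence "fps_const ((-1) ^ k * (2 * int k + 1)) = (-1) ^ k * (of_nat (n + 1 + k) - of_nat (n - k) :: int fps)"
      by (simp only: fps_const_mult[symmetric] fps_const_power[symmetric]) (simp flip: fps_const_neg)
    moreover have "E * (s * t * (u * b - v * b')) - (s * (u - v)) * t = 
        s * (u * (t * (E * b - 1)) - v * (t * (E * b' - 1)))" for E s t u v b b' :: "int fps"
      by (simp add: algebra_simps)
    ultimately show "euler_prod * ((-1) ^ k * fps_X ^ tri k * (of_nat (n + 1 + k) * B (n + 1 + k) - of_nat (n - k) * B (n - k))) - 
        fps_const ((-1) ^ k * (2 * int k + 1)) * fps_X ^ tri k = (-1) ^ k * 
     (of_nat (n + 1 + k) * (fps_X ^ tri k * (euler_prod * B (n + 1 + k) - 1)) - 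
      of_nat (n - k) * (fps_X ^ tri k * (euler_prod * B (n - k) - 1)))"
      by (simp only:)
  qed
  also have "fps_X ^ Suc n dvd \<dots>"
    by (intro dvd_sum dvd_mult dvd_diff B) auto
  finally show "fps_X ^ n dvd euler_prod * ?P n ^ 2 - ?S n"
    by (rule power_le_dvd) simp
qed


section \<open>Dissections of theta series\<close>

lemma fps_compose_uminus_uminus:
  fixes F :: "'a::comm_ring_1 fps"
  shows "(F oo - fps_X) oo - fps_X = F"
  by (simp add: fps_eq_iff fps_nth_compose_uminus_fps_X flip: mult.assoc power_add mult_2)

lemma theta_mult_odd_prod_sq: "theta * odd_prod ^ 2 = (odd_prod oo fps_X ^ 2) ^ 2 * (euler_prod oo fps_X ^ 2)"
proof -
  have "theta = theta_neg oo - fps_X"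
    by (simp add: fps_compose_uminus_uminus)
  also have "\<dots> = (odd_prod oo - fps_X) ^ 2 * (euler_prod oo fps_X ^ 2)"
    by (simp add: gauss_theta_neg fps_compose_mult_distrib fps_compose_even_uminus flip: fps_compose_power)
  finally show ?thesis
    by (simp add: odd_prod_mult_uminus[symmetric] power_mult_distrib mult_ac)
qed

lemma theta_neg_dilate_2: "theta_neg oo fps_X ^ 2 = (odd_prod oo fps_X ^ 2) ^ 2 * (euler_prod oo fps_X ^ 4)"
  by (simp add: gauss_theta_neg fps_compose_mult_distrib fps_compose_fps_X_power_power flip: fps_compose_power)

lemma euler_prod_split_2: "euler_prod oo fps_X ^ 2 = (odd_prod oo fps_X ^ 2) * (euler_prod oo fps_X ^ 4)"
  by (subst euler_prod_split) (simp add: fps_compose_mult_distrib fps_compose_fps_X_power_power)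

text \<open>
  With the product formula both sides become \<open>odd_prod\<close> in \<open>q\<^sup>2\<close>, squared, times the square of the Euler product
  in \<open>q\<^sup>2\<close>. This identity serves to clear denominators: multiplication by \<open>theta\<close>
  turns a power of \<open>theta_neg\<close> into a series in \<open>q\<^sup>2\<close>.
\<close>

lemma theta_mult_theta_neg: "theta * theta_neg = (theta_neg oo fps_X ^ 2) ^ 2"
proof -
  have "theta * theta_neg = (theta * odd_prod ^ 2) * (euler_prod oo fps_X ^ 2)"
    by (simp add: gauss_theta_neg mult_ac)
  also have "\<dots> = (theta_neg oo fps_X ^ 2) ^ 2"
    unfolding theta_mult_odd_prod_sq theta_neg_dilate_2 euler_prod_split_2
    by (simp add: power2_eq_square mult_ac)
  finally show ?thesis .
qed

text \<open>
  Even \<open>k\<close> give \<open>k\<^sup>2 = 4 * i\<^sup>2\<close>, odd \<open>k\<close> give \<open>k\<^sup>2 = 8 * tri i + 1\<close>.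
\<close>

lemma theta_dissection: "theta = (theta oo fps_X ^ 4) + 2 * fps_X * (psi oo fps_X ^ 8)"
proof (rule LIMSEQ_unique)
  let ?T = "\<lambda>N. \<Sum>k<N. fps_const (if k = 0 then 1 else 2) * fps_X ^ k\<^sup>2 :: int fps"
  let ?S = "\<lambda>N. \<Sum>k<N. fps_const 1 * fps_X ^ tri k :: int fps"
  have T: "?T \<longlonglongrightarrow> theta" unfolding theta_def by (intro LIMSEQ_lacunary power2_ge_nat)
  have S: "?S \<longlonglongrightarrow> psi" unfolding psi_def by (intro LIMSEQ_lacunary tri_ge)
  show "(\<lambda>N. ?T (2 * N)) \<longlonglongrightarrow> theta"
    by (rule filterlim_compose[OF T filterlim_double])
  have "?T (2 * N) = (?T N oo fps_X ^ 4) - (- (2 * fps_X)) * (?S N oo fps_X ^ 8)" for N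
  proof (induction N)
    case (Suc N)
    have "(2 * N + 1)\<^sup>2 = 8 * tri N + 1"
      using two_tri[of N] by (simp add: power2_eq_square algebra_simps)
    hence "fps_X ^ (2 * N + 1)\<^sup>2 = (fps_X * fps_X ^ (8 * tri N) :: int fps)"
      by simp
    moreover have "(2 * N)\<^sup>2 = 4 * N\<^sup>2" 
      by (simp add: power_mult_distrib)
    ultimately show ?case using Suc
      by (simp add: fps_compose_add_distrib fps_compose_mult_distrib fps_X_power_compose 
            numeral_fps_const[symmetric] algebra_simps flip: power_mult)
  qed auto
  hence "(\<lambda>N. ?T (2 * N)) \<longlonglongrightarrow> (theta oo fps_X ^ 4) - (- (2 * fps_X)) * (psi oo fps_X ^ 8)"
    by (simp only:) (intro tendsto_diff_fps tendsto_mult_fps tendsto_compose_fps T S tendsto_const)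
  thus "(\<lambda>N. ?T (2 * N)) \<longlonglongrightarrow> (theta oo fps_X ^ 4) + 2 * fps_X * (psi oo fps_X ^ 8)"
    by simp
qed

lemma theta_neg_dissection: "theta_neg = (theta oo fps_X ^ 4) - 2 * fps_X * (psi oo fps_X ^ 8)"
  by (subst theta_dissection) 
     (simp add: fps_compose_add_distrib fps_compose_mult_distrib fps_compose_even_uminus)

lemma fps_compose_fps_X_power_inject:
  fixes F G :: "'a::idom fps"
  assumes "F oo fps_X ^ m = G oo fps_X ^ m" "m > 0"
  shows "F = G"
proof (rule fps_ext)
  fix n
  from assms(1) have "fps_nth (F oo fps_X ^ m) (m * n) = fps_nth (G oo fps_X ^ m) (m * n)"
    by simp
  thus "fps_nth F n = fps_nth G n"
    using assms(2) by (simp add: fps_nth_compose_fps_X_power)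
qed

text \<open>
  Insert the dissections of \<open>theta\<close> and \<open>theta_neg\<close> into \<open>theta_mult_theta_neg\<close>: a difference of squares in \<open>q\<^sup>2\<close>
  appears, and \<open>q\<^sup>2\<close> can be replaced by \<open>q\<close>.
\<close>

lemma theta_neg_sq: "theta_neg ^ 2 = (theta oo fps_X ^ 2) ^ 2 - 4 * fps_X * (psi oo fps_X ^ 4) ^ 2"
proof (rule fps_compose_fps_X_power_inject)
  have "theta_neg ^ 2 oo fps_X ^ 2 = theta * theta_neg"
    by (simp add: theta_mult_theta_neg fps_compose_power)
  also have "\<dots> = (theta oo fps_X ^ 4) ^ 2 - 4 * fps_X ^ 2 * (psi oo fps_X ^ 8) ^ 2"
    unfolding theta_neg_dissection by (subst (1) theta_dissection) (simp add: algebra_simps power2_eq_square)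
  also have "\<dots> = ((theta oo fps_X ^ 2) ^ 2 - 4 * fps_X * (psi oo fps_X ^ 4) ^ 2) oo fps_X ^ 2"
    by (simp add: fps_compose_sub_distrib fps_compose_mult_distrib fps_compose_fps_X_power_power 
          flip: fps_compose_power)
  finally show "theta_neg ^ 2 oo fps_X ^ 2 = \<dots>" .
qed auto

lemma theta_sq: "theta ^ 2 = (theta oo fps_X ^ 2) ^ 2 + 4 * fps_X * (psi oo fps_X ^ 4) ^ 2"
proof -
  have "theta ^ 2 = (theta_neg oo - fps_X) ^ 2"
    by (simp add: fps_compose_uminus_uminus)
  also have "\<dots> = ((theta oo fps_X ^ 2) ^ 2 - 4 * fps_X * (psi oo fps_X ^ 4) ^ 2) oo - fps_X"
    by (simp add: theta_neg_sq fps_compose_power)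
  also have "\<dots> = (theta oo fps_X ^ 2) ^ 2 + 4 * fps_X * (psi oo fps_X ^ 4) ^ 2"
    by (simp add: fps_compose_sub_distrib fps_compose_mult_distrib fps_compose_even_uminus
          flip: fps_compose_power)
  finally show ?thesis .
qed

text \<open>
  Two evaluations of \<open>\<phi>(q)\<^sup>2 - \<phi>(-q)\<^sup>2\<close>: from the dissection of the squares, and as a product of sum
  and difference.
\<close>

lemma psi_sq: "psi ^ 2 = theta * (psi oo fps_X ^ 2)"
proof (rule fps_compose_fps_X_power_inject)
  have "8 * fps_X * (psi oo fps_X ^ 4) ^ 2 = theta ^ 2 - theta_neg ^ 2"
    unfolding theta_sq theta_neg_sq by simp
  also have "\<dots> = (theta - theta_neg) * (theta + theta_neg)"
    by (simp add: algebra_simps power2_eq_square)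
  also have "\<dots> = 8 * fps_X * ((theta oo fps_X ^ 4) * (psi oo fps_X ^ 8))"
    unfolding theta_neg_dissection by (subst (1 2) theta_dissection) (simp add: algebra_simps)
  finally have "(psi oo fps_X ^ 4) ^ 2 = (theta oo fps_X ^ 4) * (psi oo fps_X ^ 8)"
    by simp
  thus "psi ^ 2 oo fps_X ^ 4 = theta * (psi oo fps_X ^ 2) oo fps_X ^ 4"
    by (simp add: fps_compose_mult_distrib fps_compose_fps_X_power_power flip: fps_compose_power)
qed auto

text \<open>
  If \<open>D = R - 1\<close> were nonzero of order \<open>d > 0\<close>, then \<open>D * (D + 2)\<close> would have order \<open>d\<close>,
  but \<open>D(q\<^sup>2)\<close> has order \<open>2 * d\<close>.
\<close>

lemma fps_sq_eq_dilate_imp_1: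
  fixes R :: "int fps"
  assumes "R ^ 2 = R oo fps_X ^ 2" "fps_nth R 0 = 1"
  shows "R = 1"
proof (rule ccontr)
  assume "R \<noteq> 1"
  define D where "D = R - 1"
  have D: "D \<noteq> 0" "fps_nth D 0 = 0" using \<open>R \<noteq> 1\<close> assms by (simp_all add: D_def)
  have "D * (D + 2) = D oo fps_X ^ 2"
    using assms(1) by (simp add: D_def algebra_simps power2_eq_square fps_compose_sub_distrib)
  moreover have "subdegree (D + 2) = 0" "D + 2 \<noteq> 0"
    using D(2) by (auto simp: numeral_fps_const subdegree_eq_0_iff fps_eq_iff)
  moreover have "subdegree (D oo fps_X ^ 2) = subdegree D * 2"
    by (simp add: fps_X_power_subdegree)
  ultimately have "subdegree D = 0"
    using D(1) by (metis add.right_neutral mult_2_right subdegree_mult add_cancel_left_right)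
  thus False using D by (simp add: subdegree_eq_0_iff)
qed

lemma psi_nth_0: "fps_nth psi 0 = 1"
proof -
  have "{k. k = 0 \<and> tri k = 0} = {0}" by (auto simp: tri_def)
  thus ?thesis by (simp add: psi_def lacunary_def)
qed

text \<open>
  By \<open>psi_sq\<close> and the product for \<open>theta\<close>, the quotient \<open>R\<close> of the two sides satisfies
  \<open>R(q)\<^sup>2 = R(q\<^sup>2)\<close>; hence it is 1.
\<close>

lemma gauss_psi: "psi * odd_prod = euler_prod oo fps_X ^ 2"
proof -
  let ?f2 = "euler_prod oo fps_X ^ 2"
  have "?f2 dvd 1"
    by (rule fps_unit_int) (simp add: euler_prod_nth_0)
  hence "?f2 dvd psi * odd_prod"
    using dvd_trans by force
  then obtain R where R: "psi * odd_prod = ?f2 * R" by (elim dvdE)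
  have nz: "?f2 \<noteq> 0" using fps_compose_fps_X_power_inject[of euler_prod 2 0] q_prod_nonzero by auto
  have "?f2 ^ 2 * R ^ 2 = psi ^ 2 * odd_prod ^ 2"
    by (simp add: R flip: power_mult_distrib)
  also have "\<dots> = (theta * odd_prod ^ 2) * (psi oo fps_X ^ 2)"
    by (simp add: psi_sq mult_ac)
  also have "\<dots> = (odd_prod oo fps_X ^ 2) * ?f2 * (psi * odd_prod oo fps_X ^ 2)"
    unfolding theta_mult_odd_prod_sq by (simp add: fps_compose_mult_distrib power2_eq_square mult_ac)
  also have "\<dots> = ?f2 ^ 2 * (R oo fps_X ^ 2)"
  proof -
    have E: "psi * odd_prod oo fps_X ^ 2 = (euler_prod oo fps_X ^ 4) * (R oo fps_X ^ 2)"
      unfolding R by (simp add: fps_compose_mult_distrib fps_compose_fps_X_power_power)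
    have "(odd_prod oo fps_X ^ 2) * ?f2 * (psi * odd_prod oo fps_X ^ 2) = 
           ?f2 * ((odd_prod oo fps_X ^ 2) * (euler_prod oo fps_X ^ 4)) * (R oo fps_X ^ 2)"
      unfolding E by (simp only: mult_ac)
    thus ?thesis
      unfolding euler_prod_split_2[symmetric] by (simp add: power2_eq_square)
  qed
  finally have "R ^ 2 = R oo fps_X ^ 2"
    using nz by simp
  moreover have "fps_nth R 0 = 1"
  proof -
    have "fps_nth (psi * odd_prod) 0 = fps_nth (?f2 * R) 0"
      by (simp only: R)
    thus ?thesis by (simp add: psi_nth_0 euler_prod_nth_0 odd_prod_nth_0)
  qed
  ultimately have "R = 1" by (rule fps_sq_eq_dilate_imp_1)
  thus ?thesis using R by simp
qed

text \<open>
  The series \<open>\<Sum>n. F (2 * n + 1) * q ^ n\<close>: the odd part of \<open>F\<close>, divided by \<open>q\<close> and read in the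
  variable \<open>q\<^sup>2\<close>. It is linear over the series in \<open>q\<^sup>2\<close>.
\<close>

definition fps_odd_part :: "'a::comm_ring_1 fps \<Rightarrow> 'a fps" where
  "fps_odd_part F = Abs_fps (\<lambda>n. fps_nth F (2 * n + 1))"

lemma fps_odd_part_nth [simp]: "fps_nth (fps_odd_part F) n = fps_nth F (2 * n + 1)"
  by (simp add: fps_odd_part_def)

lemma fps_odd_part_mult_dilate:
  fixes F H :: "'a::comm_ring_1 fps"
  shows "fps_odd_part (F * (H oo fps_X ^ 2)) = fps_odd_part F * H"
proof (rule fps_ext)
  fix n
  have "fps_nth (fps_odd_part (F * (H oo fps_X ^ 2))) n = 
    (\<Sum>i\<in>{0..2*n+1}. fps_nth F i * (if even (2 * n + 1 - i) then fps_nth H ((2 * n + 1 - i) div 2) else 0))"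
    unfolding fps_odd_part_nth fps_mult_nth by (intro sum.cong) (simp_all add: fps_nth_compose_fps_X_power)
  also have "\<dots> = (\<Sum>i\<in>(\<lambda>j. 2 * j + 1) ` {0..n}. fps_nth F i * (if even (2 * n + 1 - i) then fps_nth H ((2 * n + 1 - i) div 2) else 0))"
  proof (rule sum.mono_neutral_right)
    show "\<forall>i\<in>{0..2*n+1} - (\<lambda>j. 2 * j + 1) ` {0..n}. fps_nth F i * (if even (2 * n + 1 - i) then fps_nth H ((2 * n + 1 - i) div 2) else 0) = 0"
    proof
      fix i assume i: "i \<in> {0..2*n+1} - (\<lambda>j. 2 * j + 1) ` {0..n}"
      have "even i"
      proof (rule ccontr)
        assume "odd i"
        then obtain j where "i = 2 * j + 1" by (elim oddE)
        with i show False by auto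
      qed
      with i show "fps_nth F i * (if even (2 * n + 1 - i) then fps_nth H ((2 * n + 1 - i) div 2) else 0) = 0"
        by auto
    qed
  qed auto
  also have "\<dots> = (\<Sum>j=0..n. fps_nth F (2 * j + 1) * fps_nth H (n - j))"
    by (subst sum.reindex) (auto simp: inj_on_def intro!: sum.cong simp flip: diff_mult_distrib2)
  also have "\<dots> = fps_nth (fps_odd_part F * H) n"
    by (simp add: fps_mult_nth)
  finally show "fps_nth (fps_odd_part (F * (H oo fps_X ^ 2))) n = fps_nth (fps_odd_part F * H) n" .
qed

lemma fps_odd_part_dilate: "fps_odd_part (H oo fps_X ^ 2) = (0 :: 'a::comm_ring_1 fps)"
  by (simp add: fps_eq_iff fps_nth_compose_fps_X_power)

lemma fps_odd_part_X_dilate: "fps_odd_part (fps_X * (H oo fps_X ^ 2)) = (H :: 'a::comm_ring_1 fps)"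
  by (simp add: fps_eq_iff fps_nth_compose_fps_X_power)

lemma fps_odd_part_add: "fps_odd_part (F + G) = fps_odd_part F + fps_odd_part G"
  by (simp add: fps_eq_iff)

lemma fps_odd_part_theta: "fps_odd_part theta = 2 * (psi oo fps_X ^ 4)"
proof -
  have "theta = ((theta oo fps_X ^ 2) oo fps_X ^ 2) + fps_X * (2 * (psi oo fps_X ^ 4) oo fps_X ^ 2)"
    by (subst theta_dissection) (simp add: fps_compose_fps_X_power_power fps_compose_mult_distrib mult_ac)
  thus ?thesis
    by (metis fps_odd_part_add fps_odd_part_dilate fps_odd_part_X_dilate add_0)
qed

lemma fps_odd_part_theta_sq: "fps_odd_part (theta ^ 2) = 4 * (psi oo fps_X ^ 2) ^ 2"
proof -
  have "theta ^ 2 = (theta ^ 2 oo fps_X ^ 2) + fps_X * (4 * (psi oo fps_X ^ 2) ^ 2 oo fps_X ^ 2)"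
    by (subst (1) theta_sq) (simp add: fps_compose_fps_X_power_power fps_compose_mult_distrib mult_ac flip: fps_compose_power)
  thus ?thesis
    by (metis fps_odd_part_add fps_odd_part_dilate fps_odd_part_X_dilate add_0)
qed

text \<open>
  In the square of \<open>theta_sq\<close> only the mixed term is odd; \<open>psi_sq\<close> simplifies it.
\<close>

lemma fps_odd_part_theta_4: "fps_odd_part (theta ^ 4) = 8 * psi ^ 4"
proof -
  have "theta ^ 4 = (theta ^ 2) ^ 2" by simp
  also have "\<dots> = ((theta oo fps_X ^ 2) ^ 2 + 4 * fps_X * (psi oo fps_X ^ 4) ^ 2) ^ 2"
    by (simp only: theta_sq)
  also have "\<dots> = (theta ^ 4 + 16 * fps_X * (psi oo fps_X ^ 2) ^ 4 oo fps_X ^ 2) + 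
             fps_X * (8 * theta ^ 2 * (psi oo fps_X ^ 2) ^ 2 oo fps_X ^ 2)"
    by (simp add: fps_compose_add_distrib fps_compose_fps_X_power_power fps_compose_mult_distrib 
          flip: fps_compose_power) (simp add: algebra_simps power2_eq_square power4_eq_xxxx)
  finally have "fps_odd_part (theta ^ 4) = 8 * theta ^ 2 * (psi oo fps_X ^ 2) ^ 2"
    by (metis fps_odd_part_add fps_odd_part_dilate fps_odd_part_X_dilate add_0)
  also have "\<dots> = 8 * psi ^ 4"
    using psi_sq by (metis power_mult_distrib mult.assoc numeral_Bit0 power_add mult_2 power_mult power2_eq_square)
  finally show ?thesis .
qed


section \<open>Generating functions of overpartitions\<close>

definition overpartitions_in :: "nat set \<Rightarrow> nat \<Rightarrow> (nat multiset \<times> nat set) set" where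
  "overpartitions_in A n = {(M, S) \<in> overpartitions n. set_mset M \<subseteq> A}"

definition overpartition_gf :: "nat set \<Rightarrow> int fps" where
  "overpartition_gf A = Abs_fps (\<lambda>n. int (card (overpartitions_in A n)))"

lemma finite_overpartitions_in: "finite (overpartitions_in A n)"
  by (rule finite_subset[OF _ finite_overpartitions]) (auto simp: overpartitions_in_def)

lemma part_le: 
  assumes "(M, S) \<in> overpartitions n" "x \<in># M"
  shows "x \<le> n"
  using assms by (auto simp: overpartitions_def dest: sum_mset.remove)

lemma overpartition_gf_empty: "overpartition_gf {} = 1"
proof -
  have "overpartitions_in {} n = (if n = 0 then {({#}, {})} else {})" for n
    by (auto simp: overpartitions_in_def overpartitions_def)
  thus ?thesis by (simp add: overpartition_gf_def fps_eq_iff)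
qed

lemma mult_one_minus_fps_X_power_nth:
  fixes F :: "'a::comm_ring_1 fps"
  shows "fps_nth (F * (1 - fps_X ^ k)) n = fps_nth F n - (if n < k then 0 else fps_nth F (n - k))"
  by (simp add: right_diff_distrib fps_X_power_mult_right_nth)

lemma mult_one_plus_fps_X_power_nth:
  fixes F :: "'a::comm_ring_1 fps"
  shows "fps_nth (F * (1 + fps_X ^ k)) n = fps_nth F n + (if n < k then 0 else fps_nth F (n - k))"
  by (simp add: distrib_left fps_X_power_mult_right_nth)

text \<open>
  Let \<open>U\<close> consist of the overpartitions in which \<open>k\<close> is not overlined, and \<open>G\<close> be its generating function. Deleting one
  copy of \<open>k\<close> maps the members of \<open>U\<close> that contain \<open>k\<close> onto \<open>U\<close>, so \<open>G * (1 - q ^ k)\<close> counts overpartitions without \<open>k\<close>.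
  Deleting the overlined copy maps the remaining overpartitions onto \<open>U\<close> as well, so all of them
  are counted by \<open>G * (1 + q ^ k)\<close>.
\<close>

lemma overpartition_gf_insert:
  assumes "k > 0" "k \<notin> A"
  shows "overpartition_gf (insert k A) * (1 - fps_X ^ k) = overpartition_gf A * (1 + fps_X ^ k)"
proof -
  let ?O = "overpartitions_in (insert k A)"
  define U where "U n = {(M, S) \<in> ?O n. k \<notin> S}" for n
  define G where "G = Abs_fps (\<lambda>n. int (card (U n)))"
  have fin: "finite (U n)" "finite {(M, S) \<in> U n. k \<in># M}" "finite {(M, S) \<in> U n. k \<notin># M}"
       "finite {(M, S) \<in> ?O n. k \<in> S}" for n
    by (rule finite_subset[OF _ finite_overpartitions_in[of "insert k A" n]]; force simp: U_def)+
  note defs = U_def overpartitions_in_def overpartitions_def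
  have remove: "card {(M, S) \<in> U n. k \<in># M} = (if n < k then 0 else card (U (n - k)))" for n
  proof (cases "n < k")
    case True
    have empty: "{(M, S) \<in> U n. k \<in># M} = {}"
      using True part_le by (fastforce simp: U_def overpartitions_in_def)
    show ?thesis unfolding empty using True by simp
  next
    case False
    have "(\<lambda>(M, S). (add_mset k M, S)) ` U (n - k) = {(M, S) \<in> U n. k \<in># M}"
    proof (intro equalityI subsetI)
      fix p assume "p \<in> {(M, S) \<in> U n. k \<in># M}"
      then obtain N S where p: "p = (add_mset k N, S)" "(add_mset k N, S) \<in> U n"
        by (cases p) (auto dest!: multi_member_split)
      hence "(N, S) \<in> U (n - k)"
        by (auto simp: defs)
      thus "p \<in> (\<lambda>(M, S). (add_mset k M, S)) ` U (n - k)"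
        using p by force
    qed (use assms False in \<open>auto simp: defs\<close>)
    moreover have "inj_on (\<lambda>(M, S). (add_mset k M, S)) (U (n - k))"
      by (auto simp: inj_on_def)
    ultimately show ?thesis using False card_image by fastforce
  qed
  have overlined: "card {(M, S) \<in> ?O n. k \<in> S} = (if n < k then 0 else card (U (n - k)))" for n
  proof (cases "n < k")
    case True
    have empty: "{(M, S) \<in> ?O n. k \<in> S} = {}"
      using True part_le by (fastforce simp: overpartitions_def overpartitions_in_def)
    show ?thesis unfolding empty using True by simp
  next
    case False
    have "(\<lambda>(M, S). (add_mset k M, insert k S)) ` U (n - k) = {(M, S) \<in> ?O n. k \<in> S}"
    proof (intro equalityI subsetI)
      fix p assume "p \<in> {(M, S) \<in> ?O n. k \<in> S}"
      then obtain M S where MS: "p = (M, S)" "(M, S) \<in> ?O n" "k \<in> S" by auto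
      moreover from this have "k \<in># M" by (auto simp: defs)
      then obtain N where N: "M = add_mset k N" by (auto dest: multi_member_split)
      ultimately have "(N, S - {k}) \<in> U (n - k)"
        by (auto simp: defs)
      moreover have "p = (add_mset k N, insert k (S - {k}))" using MS N by auto
      ultimately show "p \<in> (\<lambda>(M, S). (add_mset k M, insert k S)) ` U (n - k)"
        by force
    qed (use assms False in \<open>auto simp: defs\<close>)
    moreover have "inj_on (\<lambda>(M, S). (add_mset k M, insert k S)) (U (n - k))"
      by (auto simp: inj_on_def U_def)
    ultimately show ?thesis using False card_image by fastforce
  qed
  have U_split: "card (U n) = card (overpartitions_in A n) + card {(M, S) \<in> U n. k \<in># M}" for n
  proof -
    have "overpartitions_in A n = {(M, S) \<in> U n. k \<notin># M}"
      using assms by (auto simp: U_def overpartitions_in_def overpartitions_def)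
    moreover have "U n = {(M, S) \<in> U n. k \<notin># M} \<union> {(M, S) \<in> U n. k \<in># M}" by auto
    moreover have "{(M, S) \<in> U n. k \<notin># M} \<inter> {(M, S) \<in> U n. k \<in># M} = {}" by auto
    ultimately show ?thesis
      using card_Un_disjoint[OF fin(3) fin(2), of n n] by metis
  qed
  have O_split: "card (?O n) = card (U n) + card {(M, S) \<in> ?O n. k \<in> S}" for n
  proof -
    have "?O n = U n \<union> {(M, S) \<in> ?O n. k \<in> S}" by (auto simp: U_def)
    moreover have "U n \<inter> {(M, S) \<in> ?O n. k \<in> S} = {}" by (auto simp: U_def)
    ultimately show ?thesis
      using card_Un_disjoint[OF fin(1) fin(4), of n n] by metis
  qed
  have 1: "G * (1 - fps_X ^ k) = overpartition_gf A"
  proof (rule fps_ext)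
    fix n
    show "fps_nth (G * (1 - fps_X ^ k)) n = fps_nth (overpartition_gf A) n"
      using U_split[of n] remove[of n]
      by (simp add: mult_one_minus_fps_X_power_nth G_def overpartition_gf_def)
  qed
  have 2: "overpartition_gf (insert k A) = G * (1 + fps_X ^ k)"
    by (rule fps_ext) (simp add: mult_one_plus_fps_X_power_nth G_def overpartition_gf_def O_split overlined)
  show ?thesis
    unfolding 2 1[symmetric] by (simp add: mult_ac)
qed

lemma overpartition_gf_finite:
  fixes e :: "nat \<Rightarrow> nat" and n :: nat
  assumes "inj e" "\<And>k. 0 < e k"
  shows "overpartition_gf (e ` {..<n}) * (\<Prod>k<n. 1 - fps_X ^ e k) = (\<Prod>k<n. 1 + fps_X ^ e k)"
proof (induction n)
  case 0
  thus ?case by (simp add: overpartition_gf_empty)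
next
  case (Suc n)
  have "e n \<notin> e ` {..<n}" using assms(1) by (auto dest: injD)
  from overpartition_gf_insert[OF assms(2) this]
  have "overpartition_gf (e ` {..<Suc n}) * (1 - fps_X ^ e n) = overpartition_gf (e ` {..<n}) * (1 + fps_X ^ e n)"
    by (simp add: lessThan_Suc)
  note step = this
  have "overpartition_gf (e ` {..<Suc n}) * (\<Prod>k<Suc n. 1 - fps_X ^ e k) = 
          (overpartition_gf (e ` {..<Suc n}) * (1 - fps_X ^ e n)) * (\<Prod>k<n. 1 - fps_X ^ e k)"
    by (simp add: mult_ac)
  also have "\<dots> = (overpartition_gf (e ` {..<n}) * (\<Prod>k<n. 1 - fps_X ^ e k)) * (1 + fps_X ^ e n)"
    unfolding step by (simp only: mult_ac)
  finally show ?case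
    unfolding Suc.IH by simp
qed

lemma LIMSEQ_overpartition_gf:
  assumes "\<And>k. k < e k"
  shows "(\<lambda>n. overpartition_gf (e ` {..<n})) \<longlonglongrightarrow> overpartition_gf (range e)"
proof (rule tendsto_fpsI)
  fix m
  show "eventually (\<lambda>n. fps_nth (overpartition_gf (e ` {..<n})) m = fps_nth (overpartition_gf (range e)) m) sequentially"
    using eventually_gt_at_top[of m]
  proof eventually_elim
    case (elim n)
    have "overpartitions_in (e ` {..<n}) m = overpartitions_in (range e) m"
    proof (intro equalityI subsetI; clarify)
      fix M S assume *: "(M, S) \<in> overpartitions_in (range e) m"
      have "x \<in> e ` {..<n}" if "x \<in># M" for x
      proof -
        from * that obtain k where k: "x = e k" by (auto simp: overpartitions_in_def)
        have "x \<le> m" using part_le * that by (auto simp: overpartitions_in_def)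
        thus ?thesis using k elim assms[of k] by auto
      qed
      thus "(M, S) \<in> overpartitions_in (e ` {..<n}) m"
        using * by (auto simp: overpartitions_in_def)
    qed (auto simp: overpartitions_in_def)
    thus ?case by (simp add: overpartition_gf_def)
  qed
qed

lemma range_odd: "range (\<lambda>k. 2 * k + 1) = {n::nat. odd n}"
  by (auto elim!: oddE)

lemma overpartition_gf_odd: "overpartition_gf {n. odd n} * odd_prod = odd_prod oo - fps_X"
proof (rule LIMSEQ_unique)
  let ?e = "\<lambda>k::nat. 2 * k + 1"
  have L: "(\<lambda>n. overpartition_gf (?e ` {..<n})) \<longlonglongrightarrow> overpartition_gf {n. odd n}"
    unfolding range_odd[symmetric] by (rule LIMSEQ_overpartition_gf) auto
  have "overpartition_gf (?e ` {..<n}) * (\<Prod>k<n. 1 - fps_X ^ ?e k) = (\<Prod>k<n. 1 - fps_X ^ ?e k) oo - fps_X" for n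
  proof -
    have "(1 - fps_X ^ ?e k) oo - fps_X = (1 + fps_X ^ ?e k :: int fps)" for k
      by (simp add: fps_compose_sub_distrib fps_compose_mult_distrib fps_X_power_compose)
    thus ?thesis
      using overpartition_gf_finite[of ?e n] by (simp add: fps_compose_prod_distrib inj_def del: power_Suc)
  qed
  with tendsto_mult_fps[OF L LIMSEQ_odd_prod]
  show "(\<lambda>n. (\<Prod>k<n. 1 - fps_X ^ ?e k) oo - fps_X) \<longlonglongrightarrow> overpartition_gf {n. odd n} * odd_prod" 
    by simp
  show "(\<lambda>n. (\<Prod>k<n. 1 - fps_X ^ ?e k) oo - fps_X) \<longlonglongrightarrow> (odd_prod oo - fps_X)"
    by (intro tendsto_compose_fps LIMSEQ_odd_prod)
qed

text \<open>
  The generating function is the product of \<open>(1 + q ^ (2 * k)) / (1 - q ^ (2 * k))\<close>; multiplication by the square of the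
  Euler product in \<open>q\<^sup>2\<close> leaves the product of all \<open>1 - q ^ (4 * k)\<close>. The parts are enumerated from 2, since
  0 is even but never a part.
\<close>

lemma overpartition_gf_even:
  "overpartition_gf {n. even n} * (euler_prod oo fps_X ^ 2) ^ 2 = euler_prod oo fps_X ^ 4"
proof (rule LIMSEQ_unique)
  let ?e = "\<lambda>k::nat. 2 * Suc k"
  let ?P = "\<lambda>n. (\<Prod>k<n. 1 - fps_X ^ Suc k :: int fps)"
  have "overpartition_gf (range ?e) = overpartition_gf {n. even n}"
  proof -
    have "overpartitions_in (range ?e) n = overpartitions_in {n. even n} n" for n
    proof -
      have "x \<in> range ?e \<longleftrightarrow> even x" if "x \<noteq> 0" for x
        using that by (auto elim!: evenE intro!: image_eqI[of _ _ "x div 2 - 1"])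
      hence "set_mset M \<subseteq> range ?e \<longleftrightarrow> set_mset M \<subseteq> {n. even n}" if "0 \<notin># M" for M
        unfolding subset_iff using that by (metis mem_Collect_eq)
      thus ?thesis
        by (auto simp: overpartitions_in_def overpartitions_def)
    qed
    thus ?thesis by (simp add: overpartition_gf_def)
  qed
  hence L: "(\<lambda>n. overpartition_gf (?e ` {..<n})) \<longlonglongrightarrow> overpartition_gf {n. even n}"
    using LIMSEQ_overpartition_gf[of ?e] by auto
  have "overpartition_gf (?e ` {..<n}) * (?P n oo fps_X ^ 2) ^ 2 = ?P n oo fps_X ^ 4" for n
  proof -
    have P: "?P n oo fps_X ^ m = (\<Prod>k<n. 1 - fps_X ^ (m * Suc k))" if "m > 0" for m
      using that by (simp add: fps_compose_prod_distrib fps_compose_sub_distrib fps_X_power_compose del: power_Suc mult_Suc_right flip: power_mult)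
    have "overpartition_gf (?e ` {..<n}) * (?P n oo fps_X ^ 2) ^ 2 = (\<Prod>k<n. 1 + fps_X ^ ?e k) * (\<Prod>k<n. 1 - fps_X ^ ?e k)"
      using overpartition_gf_finite[of ?e n] by (simp add: P inj_def power2_eq_square[of "prod _ _"] del: power_Suc mult_Suc_right flip: mult.assoc)
    also have "\<dots> = (\<Prod>k<n. 1 - fps_X ^ (4 * Suc k))"
      unfolding prod.distrib[symmetric]
    proof (intro prod.cong refl)
      fix k
      have "4 * Suc k = ?e k + ?e k" by simp
      hence "fps_X ^ (4 * Suc k) = (fps_X ^ ?e k * fps_X ^ ?e k :: int fps)"
        by (simp only: power_add)
      thus "(1 + fps_X ^ ?e k) * (1 - fps_X ^ ?e k) = (1 - fps_X ^ (4 * Suc k) :: int fps)"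
        by (simp add: algebra_simps del: power_Suc mult_Suc_right)
    qed
    finally have "overpartition_gf (?e ` {..<n}) * (?P n oo fps_X ^ 2) ^ 2 = (\<Prod>k<n. 1 - fps_X ^ (4 * Suc k))" .
    moreover have "?P n oo fps_X ^ 4 = (\<Prod>k<n. 1 - fps_X ^ (4 * Suc k))"
      by (rule P) simp
    ultimately show ?thesis by (simp only:)
  qed
  hence "(\<lambda>n. ?P n oo fps_X ^ 4) = (\<lambda>n. overpartition_gf (?e ` {..<n}) * (?P n oo fps_X ^ 2) ^ 2)" 
    by simp
  also have "\<dots> \<longlonglongrightarrow> overpartition_gf {n. even n} * (euler_prod oo fps_X ^ 2) ^ 2"
    by (intro tendsto_mult_fps tendsto_power_fps tendsto_compose_fps LIMSEQ_euler_prod L)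
  finally show "(\<lambda>n. ?P n oo fps_X ^ 4) \<longlonglongrightarrow> overpartition_gf {n. even n} * (euler_prod oo fps_X ^ 2) ^ 2" .
  show "(\<lambda>n. ?P n oo fps_X ^ 4) \<longlonglongrightarrow> (euler_prod oo fps_X ^ 4)"
    by (intro tendsto_compose_fps LIMSEQ_euler_prod)
qed


section \<open>The generating function of \<open>SOME_bar\<close>\<close>

lemma filter_mset_id: "(\<And>x. x \<in># M \<Longrightarrow> P x) \<Longrightarrow> filter_mset P M = M"
  by (rule multiset_eqI) (auto simp: count_eq_zero_iff)

lemma filter_mset_none: "(\<And>x. x \<in># M \<Longrightarrow> \<not> P x) \<Longrightarrow> filter_mset P M = {#}"
  by (rule multiset_eqI) (auto simp: count_eq_zero_iff)

text \<open>
  An overpartition splits uniquely into its odd and its even parts, of total sizes \<open>a\<close> and \<open>n - a\<close>, and then has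
  weight \<open>a - (n - a)\<close>.
\<close>

lemma SOME_bar_convolution:
  "SOME_bar n = (\<Sum>a=0..n. (int a - int (n - a)) * int (card (overpartitions_in {n. odd n} a)) * 
     int (card (overpartitions_in {n. even n} (n - a))))"
proof -
  let ?O = "overpartitions_in {n. odd n}" and ?E = "overpartitions_in {n. even n}"
  let ?D = "SIGMA a:{0..n}. ?O a \<times> ?E (n - a)"
  have odd_part: "filter_mset odd M = M" "filter_mset even M = {#}" if "(M, S) \<in> ?O a" for M S a
    using that by (auto simp: overpartitions_in_def subset_iff intro!: filter_mset_id filter_mset_none)
  have even_part: "filter_mset even M = M" "filter_mset odd M = {#}" if "(M, S) \<in> ?E a" for M S a
    using that by (auto simp: overpartitions_in_def subset_iff intro!: filter_mset_id filter_mset_none)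
  have S_odd: "S \<inter> {n. odd n} = S" "S \<inter> {n. even n} = {}" if "(M, S) \<in> ?O a" for M S a
    using that by (auto simp: overpartitions_in_def overpartitions_def)
  have S_even: "S \<inter> {n. even n} = S" "S \<inter> {n. odd n} = {}" if "(M, S) \<in> ?E a" for M S a
    using that by (auto simp: overpartitions_in_def overpartitions_def)
  have sum_split: "sum_mset (filter_mset odd M) + sum_mset (filter_mset even M) = sum_mset M" for M :: "nat multiset"
    using multiset_partition[of M odd] by (metis sum_mset.union)
  have union_split: "filter_mset odd M + filter_mset even M = M" for M :: "nat multiset"
    using multiset_partition[of M odd] by metis
  have "SOME_bar n = (\<Sum>(a, (M, S), (N, T))\<in>?D. int a - int (n - a))"
    unfolding SOME_bar_def
  proof (rule sum.reindex_bij_witness[of _ 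
      "\<lambda>(a, (M, S), (N, T)). (M + N, S \<union> T)"
      "\<lambda>(M, S). (sum_mset (filter_mset odd M), (filter_mset odd M, S \<inter> {n. odd n}), (filter_mset even M, S \<inter> {n. even n}))"], goal_cases)
    case (1 p)
    thus ?case by (cases p) (auto simp: union_split)
  next
    case (2 p)
    obtain M S where p: "p = (M, S)" by (cases p)
    have "sum_mset (filter_mset even M) = n - sum_mset (filter_mset odd M)" "sum_mset (filter_mset odd M) \<le> n"
      using 2 sum_split[of M] by (auto simp: p overpartitions_def)
    thus ?case using 2 by (auto simp: p overpartitions_in_def overpartitions_def)
  next
    case (3 q)
    then obtain a M S N T where q: "q = (a, (M, S), (N, T))" "(M, S) \<in> ?O a" "(N, T) \<in> ?E (n - a)" "a \<le> n"
      by auto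
    have "sum_mset M = a" using q(2) by (auto simp: overpartitions_in_def overpartitions_def)
    thus ?case using q 
      by (simp add: odd_part[OF q(2)] even_part[OF q(3)] S_odd[OF q(2)] S_even[OF q(3)] Int_Un_distrib2)
  next
    case (4 q)
    thus ?case by (auto simp: overpartitions_in_def overpartitions_def)
  next
    case (5 p)
    obtain M S where p: "p = (M, S)" by (cases p)
    have "sum_mset (filter_mset even M) = n - sum_mset (filter_mset odd M)"
      using 5 sum_split[of M] by (auto simp: p overpartitions_def)
    thus ?case by (simp only: p odd_minus_even_def prod.case)
  qed
  also have "\<dots> = (\<Sum>a=0..n. \<Sum>_\<in>?O a \<times> ?E (n - a). int a - int (n - a))"
    by (subst sum.Sigma) (auto simp: finite_overpartitions_in case_prod_unfold)
  also have "\<dots> = (\<Sum>a=0..n. (int a - int (n - a)) * int (card (?O a)) * int (card (?E (n - a))))"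
    by (simp add: mult_ac card_cartesian_product)
  finally show ?thesis .
qed

definition SOME_gf :: "int fps" where "SOME_gf = Abs_fps SOME_bar"

abbreviation euler_op :: "int fps \<Rightarrow> int fps" where
  "euler_op F \<equiv> fps_X * fps_deriv F"

text \<open>
  The operator \<open>q d/dq\<close> multiplies the coefficient of \<open>q ^ a\<close> by \<open>a\<close>, so the convolution is a
  difference of two products.
\<close>

lemma SOME_gf_eq:
  "SOME_gf = euler_op (overpartition_gf {n. odd n}) * overpartition_gf {n. even n} -
             overpartition_gf {n. odd n} * euler_op (overpartition_gf {n. even n})"
proof (rule fps_ext)
  fix n
  show "fps_nth SOME_gf n = fps_nth (euler_op (overpartition_gf {n. odd n}) * overpartition_gf {n. even n} -
             overpartition_gf {n. odd n} * euler_op (overpartition_gf {n. even n})) n"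
    unfolding fps_mult_fps_X_deriv_shift fps_sub_nth fps_mult_nth sum_subtractf[symmetric]
    by (simp add: SOME_gf_def SOME_bar_convolution overpartition_gf_def algebra_simps)
qed

lemma overpartition_gf_even_theta: "overpartition_gf {n. even n} * (theta_neg oo fps_X ^ 2) = 1"
proof -
  let ?f4 = "euler_prod oo fps_X ^ 4"
  have nz: "?f4 \<noteq> 0" using fps_compose_fps_X_power_inject[of euler_prod 4 0] q_prod_nonzero by auto
  have "?f4 * (overpartition_gf {n. even n} * (theta_neg oo fps_X ^ 2)) = 
        overpartition_gf {n. even n} * (euler_prod oo fps_X ^ 2) ^ 2"
    unfolding theta_neg_dilate_2 euler_prod_split_2 by (simp add: power2_eq_square mult_ac)
  also have "\<dots> = ?f4 * 1" by (simp add: overpartition_gf_even)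
  finally show ?thesis using nz by (simp only: mult_cancel_left) simp
qed

lemma overpartition_gf_odd_theta: "overpartition_gf {n. odd n} = theta * overpartition_gf {n. even n}"
proof -
  let ?f4 = "euler_prod oo fps_X ^ 4" and ?E = "overpartition_gf {n. even n}"
  have nz: "?f4 \<noteq> 0" using fps_compose_fps_X_power_inject[of euler_prod 4 0] q_prod_nonzero by auto
  have "(odd_prod * ?f4) * (odd_prod * overpartition_gf {n. odd n}) = odd_prod * (odd_prod oo - fps_X) * ?f4"
    by (simp add: overpartition_gf_odd[symmetric] mult_ac)
  also have "\<dots> = (odd_prod oo fps_X ^ 2) * ?f4"
    by (simp add: odd_prod_mult_uminus)
  also have "\<dots> = (odd_prod oo fps_X ^ 2) * (?E * (theta_neg oo fps_X ^ 2)) * ?f4"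
    by (simp add: overpartition_gf_even_theta)
  also have "\<dots> = ?E * (odd_prod oo fps_X ^ 2) ^ 2 * ((odd_prod oo fps_X ^ 2) * ?f4) * ?f4"
    unfolding theta_neg_dilate_2 by (simp only: power2_eq_square mult_ac)
  also have "\<dots> = ?E * (theta * odd_prod ^ 2) * ?f4"
    by (simp add: theta_mult_odd_prod_sq mult_ac flip: euler_prod_split_2)
  also have "\<dots> = (odd_prod * ?f4) * (odd_prod * (theta * ?E))"
    by (simp add: power2_eq_square mult_ac)
  finally show ?thesis using nz q_prod_nonzero by simp
qed

text \<open>
  Let \<open>E\<close> count the overpartitions into even parts. Those into odd parts are counted by \<open>theta * E\<close>. In
  \<open>SOME_gf_eq\<close> the derivative of \<open>E\<close> cancels, which leaves the derivative of \<open>theta\<close> times \<open>E\<^sup>2\<close>, and \<open>E\<close> is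
  inverse to \<open>\<phi>(-q\<^sup>2)\<close>.
\<close>

lemma SOME_gf_theta: "SOME_gf * (theta_neg oo fps_X ^ 2) ^ 2 = euler_op theta"
proof -
  let ?E = "overpartition_gf {n. even n}" and ?T = "theta_neg oo fps_X ^ 2"
  have "SOME_gf = euler_op theta * ?E ^ 2"
    unfolding SOME_gf_eq overpartition_gf_odd_theta by (simp add: algebra_simps power2_eq_square)
  hence "SOME_gf * ?T ^ 2 = euler_op theta * (?E * ?T) ^ 2"
    by (simp add: power2_eq_square mult_ac)
  thus ?thesis by (simp add: overpartition_gf_even_theta)
qed

text \<open>
  Since \<open>8 * tri i + 1 = (2 * i + 1)\<^sup>2\<close>, this is \<open>\<Sum>i. (2 * i + 1)\<^sup>2 * q ^ tri i\<close>.
\<close>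

definition psi_weighted :: "int fps" where
  "psi_weighted = Abs_fps (\<lambda>n. (8 * int n + 1) * fps_nth psi n)"

lemma fps_odd_part_euler_op_theta: "fps_odd_part (euler_op theta) = 2 * (psi_weighted oo fps_X ^ 4)"
proof (rule fps_ext)
  fix n
  have "fps_nth (fps_odd_part (euler_op theta)) n = (2 * int n + 1) * fps_nth (fps_odd_part theta) n"
    by (simp add: fps_mult_fps_X_deriv_shift)
  also have "\<dots> = fps_nth (2 * (psi_weighted oo fps_X ^ 4)) n"
    by (auto simp: fps_odd_part_theta numeral_fps_const fps_nth_compose_fps_X_power psi_weighted_def elim!: dvdE)
  finally show "fps_nth (fps_odd_part (euler_op theta)) n = fps_nth (2 * (psi_weighted oo fps_X ^ 4)) n" .
qed

lemma theta_neg_power: "theta_neg ^ (2 * m) oo fps_X ^ 2 = theta ^ m * theta_neg ^ m"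
  by (simp add: power_mult_distrib power_mult flip: fps_compose_power theta_mult_theta_neg)

text \<open>
  As \<open>8 * n + 7\<close> is \<open>m \<mapsto> 2 * m + 1\<close> iterated three times on \<open>n\<close>, the odd part is taken three times in
  \<open>SOME_gf_theta\<close>. Before the second and the third step, a power of \<open>theta\<close> makes the denominator a series in \<open>q\<^sup>2\<close>.
\<close>

lemma SOME_bar_8n_7:
  "Abs_fps (\<lambda>n. SOME_bar (8 * n + 7)) * theta_neg ^ 8 = 64 * psi_weighted * psi ^ 6"
proof -
  (* The coefficients of index 2n + 1, 4n + 3 and 8n + 7, respectively. *)
  define g1 where "g1 = fps_odd_part SOME_gf"
  define g2 where "g2 = fps_odd_part g1"
  define g3 where "g3 = fps_odd_part g2"
  have comp: "(F oo fps_X ^ 2) ^ m = F ^ m oo fps_X ^ 2" for F :: "int fps" and m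
    by (simp add: fps_compose_power)
  have odd_mult: "fps_odd_part ((H oo fps_X ^ 2) * F) = H * fps_odd_part F" for F H :: "int fps"
    by (simp add: fps_odd_part_mult_dilate mult.commute)
  have "g1 * theta_neg ^ 2 = fps_odd_part (SOME_gf * (theta_neg oo fps_X ^ 2) ^ 2)"
    by (simp add: g1_def comp fps_odd_part_mult_dilate)
  also have "\<dots> = 2 * (psi_weighted oo fps_X ^ 4)"
    by (simp add: SOME_gf_theta fps_odd_part_euler_op_theta)
  finally have g1: "g1 * theta_neg ^ 2 = 2 * (psi_weighted oo fps_X ^ 4)" .

  have "g1 * (theta_neg ^ 4 oo fps_X ^ 2) = (g1 * theta_neg ^ 2) * theta ^ 2"
    using theta_neg_power[of 2] by (simp add: mult_ac)
  also have "\<dots> = (2 * (psi_weighted oo fps_X ^ 2) oo fps_X ^ 2) * theta ^ 2"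
    by (simp add: g1 fps_compose_mult_distrib fps_compose_fps_X_power_power)
  finally have "fps_odd_part (g1 * (theta_neg ^ 4 oo fps_X ^ 2)) = 
                fps_odd_part ((2 * (psi_weighted oo fps_X ^ 2) oo fps_X ^ 2) * theta ^ 2)"
    by simp
  hence g2: "g2 * theta_neg ^ 4 = 8 * ((psi_weighted oo fps_X ^ 2) * (psi oo fps_X ^ 2) ^ 2)"
    unfolding odd_mult fps_odd_part_mult_dilate fps_odd_part_theta_sq by (simp add: g2_def mult_ac)

  have "g2 * (theta_neg ^ 8 oo fps_X ^ 2) = (g2 * theta_neg ^ 4) * theta ^ 4"
    using theta_neg_power[of 4] by (simp add: mult_ac)
  also have "\<dots> = (8 * psi_weighted * psi ^ 2 oo fps_X ^ 2) * theta ^ 4"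
    by (simp add: g2 fps_compose_mult_distrib comp mult_ac)
  finally have "fps_odd_part (g2 * (theta_neg ^ 8 oo fps_X ^ 2)) = 
                fps_odd_part ((8 * psi_weighted * psi ^ 2 oo fps_X ^ 2) * theta ^ 4)"
    by simp
  hence "g3 * theta_neg ^ 8 = 64 * psi_weighted * psi ^ 6"
    unfolding odd_mult fps_odd_part_mult_dilate fps_odd_part_theta_4 by (simp add: g3_def mult_ac flip: power_add)
  moreover have "g3 = Abs_fps (\<lambda>n. SOME_bar (8 * n + 7))"
    by (simp add: fps_eq_iff g3_def g2_def g1_def SOME_gf_def algebra_simps eval_nat_numeral)
  ultimately show ?thesis by simp
qed


section \<open>Reduction modulo 5\<close>

lemma dvd_5_fps_iff: "5 dvd (F :: int fps) \<longleftrightarrow> (\<forall>n. 5 dvd fps_nth F n)"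
proof
  assume "5 dvd F"
  thus "\<forall>n. 5 dvd fps_nth F n"
    by (auto elim!: dvdE simp: numeral_fps_const)
next
  assume "\<forall>n. 5 dvd fps_nth F n"
  hence "F = 5 * Abs_fps (\<lambda>n. fps_nth F n div 5)"
    by (auto simp: fps_eq_iff numeral_fps_const)
  thus "5 dvd F" by (metis dvd_triv_left)
qed

text \<open>
  The Frobenius congruence modulo 5, factor by factor.
\<close>

lemma euler_prod_power_5: "5 dvd euler_prod ^ 5 - (euler_prod oo fps_X ^ 5)"
proof -
  let ?P = "\<lambda>n. \<Prod>k<n. 1 - fps_X ^ Suc k :: int fps"
  have "5 dvd ?P n ^ 5 - (?P n oo fps_X ^ 5)" for n
  proof (induction n)
    case (Suc n)
    define Y :: "int fps" where "Y = fps_X ^ Suc n"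
    have Y: "(1 - Y) oo fps_X ^ 5 = 1 - Y ^ 5"
      by (simp add: Y_def fps_compose_sub_distrib fps_X_power_compose mult.commute del: power_Suc flip: power_mult)
    have "(1 - Y) ^ 5 - (1 - Y ^ 5) = 5 * (- Y + 2 * Y ^ 2 - 2 * Y ^ 3 + Y ^ 4)"
      by (simp add: eval_nat_numeral algebra_simps)
    hence "5 dvd (1 - Y) ^ 5 - (1 - Y ^ 5)" by (metis dvd_triv_left)
    moreover have "?P (Suc n) ^ 5 - (?P (Suc n) oo fps_X ^ 5) = 
       ?P n ^ 5 * ((1 - Y) ^ 5 - (1 - Y ^ 5)) + (1 - Y ^ 5) * (?P n ^ 5 - (?P n oo fps_X ^ 5))"
      by (simp add: fps_compose_mult_distrib Y power_mult_distrib flip: Y_def del: power_Suc) 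
         (simp add: algebra_simps)
    ultimately show ?case using Suc.IH by simp
  qed simp
  note partial = this
  have lim: "(\<lambda>n. ?P n ^ 5 - (?P n oo fps_X ^ 5)) \<longlonglongrightarrow> euler_prod ^ 5 - (euler_prod oo fps_X ^ 5)"
    by (intro tendsto_diff_fps tendsto_power_fps tendsto_compose_fps LIMSEQ_euler_prod)
  have "5 dvd fps_nth (euler_prod ^ 5 - (euler_prod oo fps_X ^ 5)) m" for m
  proof -
    from lim obtain n where "fps_nth (?P n ^ 5 - (?P n oo fps_X ^ 5)) m = fps_nth (euler_prod ^ 5 - (euler_prod oo fps_X ^ 5)) m"
      unfolding tendsto_fps_iff eventually_sequentially by blast
    moreover have "5 dvd fps_nth (?P n ^ 5 - (?P n oo fps_X ^ 5)) m"
      using partial[of n] unfolding dvd_5_fps_iff by blast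
    ultimately show ?thesis by (simp only:)
  qed
  thus ?thesis unfolding dvd_5_fps_iff by blast
qed

text \<open>
  Multiplication by a series in \<open>q\<^sup>5\<close> preserves this property, and if the series is a unit then
  the multiplication can be undone.
\<close>

definition zero_mod_5_at_3_4 :: "int fps \<Rightarrow> bool" where
  "zero_mod_5_at_3_4 F \<longleftrightarrow> (\<forall>n. n mod 5 \<in> {3, 4} \<longrightarrow> 5 dvd fps_nth F n)"

lemma zero_mod_5_at_3_4_mult:
  assumes "zero_mod_5_at_3_4 F"
  shows "zero_mod_5_at_3_4 (F * (H oo fps_X ^ 5))"
  unfolding zero_mod_5_at_3_4_def fps_mult_nth
proof (intro allI impI dvd_sum)
  fix n i :: nat assume n: "n mod 5 \<in> {3, 4}" and i: "i \<in> {0..n}"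
  show "5 dvd fps_nth F i * fps_nth (H oo fps_X ^ 5) (n - i)"
  proof (cases "5 dvd n - i")
    case True
    hence "i mod 5 = n mod 5" using i mod_eq_dvd_iff_nat[of i n 5] by simp
    hence "5 dvd fps_nth F i" using n assms by (auto simp: zero_mod_5_at_3_4_def)
    thus ?thesis by simp
  qed (simp add: fps_nth_compose_fps_X_power)
qed

lemma zero_mod_5_at_3_4_cancel:
  assumes "zero_mod_5_at_3_4 (F * (H oo fps_X ^ 5))" "fps_nth H 0 = 1"
  shows "zero_mod_5_at_3_4 F"
proof -
  obtain W where W: "1 = H * W" using fps_unit_int[OF assms(2)] by (elim dvdE)
  have "(H oo fps_X ^ 5) * (W oo fps_X ^ 5) = 1"
    by (simp flip: fps_compose_mult_distrib W)
  hence "F * (H oo fps_X ^ 5) * (W oo fps_X ^ 5) = F"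
    by (simp only: mult.assoc mult_1_right)
  thus ?thesis using zero_mod_5_at_3_4_mult[OF assms(1), of W] by (simp only:)
qed

lemma zero_mod_5_at_3_4_cong:
  assumes "zero_mod_5_at_3_4 G" "5 dvd F - G"
  shows "zero_mod_5_at_3_4 F"
  unfolding zero_mod_5_at_3_4_def
proof (intro allI impI)
  fix n :: nat assume "n mod 5 \<in> {3, 4}"
  hence "5 dvd fps_nth G n" using assms(1) by (auto simp: zero_mod_5_at_3_4_def)
  moreover have "5 dvd fps_nth F n - fps_nth G n" using assms(2) by (simp add: dvd_5_fps_iff)
  ultimately show "5 dvd fps_nth F n" by (metis dvd_add diff_add_cancel)
qed

lemma tri_mod_5: "tri k mod 5 = 3 * ((k mod 5) * (k mod 5 + 1)) mod 5"
proof -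
  (* 3 is the inverse of 2 modulo 5. *)
  have "tri k mod 5 = 3 * (2 * tri k) mod 5" by presburger
  also have "\<dots> = 3 * ((k mod 5) * (k mod 5 + 1)) mod 5"
    unfolding two_tri by (intro mod_mult_cong mod_add_cong) simp_all
  finally show ?thesis .
qed

text \<open>
  Modulo 5 a triangular number is 0, 1 or 3, and it is 3 only for indices congruent to 2. The sums of two
  members of \<open>{0, 1}\<close> are 0, 1 and 2.
\<close>

lemma tri_sum_mod_5:
  assumes "(tri i + tri j) mod 5 \<in> {3, 4}"
  shows "i mod 5 = 2 \<or> j mod 5 = 2"
proof -
  have *: "tri k mod 5 = 0 \<or> tri k mod 5 = 1" if "k mod 5 \<noteq> 2" for k
  proof -
    have "k mod 5 < 5" by simp
    hence "k mod 5 \<in> {0, 1, 3, 4}" using that by auto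
    thus ?thesis by (auto simp: tri_mod_5)
  qed
  have sum: "(tri i mod 5 + tri j mod 5) mod 5 \<in> {3, 4}"
    using assms by (simp only: mod_add_eq)
  show ?thesis
  proof (rule ccontr)
    assume "\<not> ?thesis"
    hence "tri i mod 5 \<in> {0, 1}" "tri j mod 5 \<in> {0, 1}" using *[of i] *[of j] by simp_all
    thus False using sum by auto
  qed
qed

lemma dvd_5_iff: "5 dvd (2 * int k + 1) \<longleftrightarrow> k mod 5 = 2"
  by presburger

text \<open>
  A term of the product is \<open>(2 * i + 1)\<^sup>2 * (2 * j + 1)\<close> up to sign, at the exponent \<open>tri i + tri j\<close>. For exponents
  congruent to 3 or 4, one of the indices is congruent to 2, so that 5 divides \<open>2 * i + 1\<close> or \<open>2 * j + 1\<close>.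
\<close>

lemma psi_weighted_jacobi_cube: "zero_mod_5_at_3_4 (psi_weighted * jacobi_cube)"
  unfolding zero_mod_5_at_3_4_def fps_mult_nth
proof (intro allI impI dvd_sum)
  fix n a :: nat assume n: "n mod 5 \<in> {3, 4}" and a: "a \<in> {0..n}"
  show "5 dvd fps_nth psi_weighted a * fps_nth jacobi_cube (n - a)"
  proof (cases "\<exists>i. tri i = a")
    case False
    hence "fps_nth psi_weighted a = 0"
      by (simp add: psi_weighted_def psi_def lacunary_def)
    thus ?thesis by simp
  next
    case True
    then obtain i where i: "tri i = a" by blast
    have "8 * int a + 1 = (2 * int i + 1) ^ 2"
    proof -
      have "int (2 * tri i) = int (i * (i + 1))" by (simp only: two_tri)
      thus ?thesis by (simp add: i power2_eq_square algebra_simps)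
    qed
    hence psi_w: "(2 * int i + 1) dvd fps_nth psi_weighted a"
      by (simp add: psi_weighted_def power2_eq_square)
    show ?thesis
    proof (cases "i mod 5 = 2")
      case True
      thus ?thesis using psi_w dvd_5_iff by (meson dvd_trans dvd_mult2)
    next
      case False
      have "5 dvd fps_nth jacobi_cube (n - a)"
        unfolding jacobi_cube_def lacunary_def fps_nth_Abs_fps
      proof (intro dvd_sum dvd_mult)
        fix j assume "j \<in> {k. k \<le> n - a \<and> tri k = n - a}"
        hence "tri i + tri j = n" using a i by auto
        hence "j mod 5 = 2" using n False tri_sum_mod_5 by metis
        thus "5 dvd (2 * int j + 1)" by (simp add: dvd_5_iff)
      qed
      thus ?thesis by simp
    qed
  qed
qed

lemma dvd_power_diff:
  fixes a b :: "'a::comm_ring_1"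
  assumes "d dvd a - b"
  shows "d dvd a ^ n - b ^ n"
proof (induction n)
  case (Suc n)
  have "a ^ Suc n - b ^ Suc n = a * (a ^ n - b ^ n) + (a - b) * b ^ n"
    by (simp add: algebra_simps)
  thus ?case using Suc assms by simp
qed simp

text \<open>
  Both theta series in \<open>SOME_bar_8n_7\<close> are quotients of Euler products: \<open>\<phi>(-q) = f\<^sub>1\<^sup>2 / f\<^sub>2\<close> and
  \<open>\<psi>(q) = f\<^sub>2\<^sup>2 / f\<^sub>1\<close>, with \<open>f\<^sub>m\<close> the Euler product in \<open>q ^ m\<close>. So \<open>\<psi>(q) ^ 6 / \<phi>(-q) ^ 8\<close> is \<open>f\<^sub>2 ^ 20 / f\<^sub>1 ^ 22\<close>. The factor
  \<open>f\<^sub>1 ^ 3\<close>, which is Jacobi's series, raises the exponent 22 of the denominator to a multiple of 5.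
\<close>

lemma SOME_bar_8n_7_euler_prod:
  "Abs_fps (\<lambda>n. SOME_bar (8 * n + 7)) * (euler_prod ^ 5) ^ 5 = 
     64 * psi_weighted * jacobi_cube * (euler_prod ^ 5 oo fps_X ^ 2) ^ 4"
proof -
  let ?U = "Abs_fps (\<lambda>n. SOME_bar (8 * n + 7))" and ?f2 = "euler_prod oo fps_X ^ 2"
  have theta: "theta_neg * ?f2 = euler_prod ^ 2"
    by (subst (2) euler_prod_split) (simp add: gauss_theta_neg power2_eq_square mult_ac)
  have psi: "psi * euler_prod = ?f2 ^ 2"
    by (subst euler_prod_split) (simp add: power2_eq_square gauss_psi flip: mult.assoc)
  have "?U * (euler_prod ^ 5) ^ 5 = ?U * (euler_prod ^ 2) ^ 8 * euler_prod ^ 6 * euler_prod ^ 3"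
    by (simp flip: power_mult power_add mult.assoc add: mult.assoc)
  also have "\<dots> = (?U * theta_neg ^ 8) * ?f2 ^ 8 * euler_prod ^ 6 * jacobi_cube"
    unfolding theta[symmetric] euler_prod_cube by (simp only: power_mult_distrib mult_ac)
  also have "\<dots> = 64 * psi_weighted * jacobi_cube * (psi * euler_prod) ^ 6 * ?f2 ^ 8"
    unfolding SOME_bar_8n_7 by (simp only: power_mult_distrib mult_ac)
  also have "\<dots> = 64 * psi_weighted * jacobi_cube * (euler_prod ^ 5 oo fps_X ^ 2) ^ 4"
    unfolding psi by (simp add: mult.assoc flip: power_mult power_add fps_compose_power)
  finally show ?thesis .
qed

lemma SOME_bar_8n_7_mod_5: "zero_mod_5_at_3_4 (Abs_fps (\<lambda>n. SOME_bar (8 * n + 7)))"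
proof (rule zero_mod_5_at_3_4_cancel)
  let ?U = "Abs_fps (\<lambda>n. SOME_bar (8 * n + 7))" and ?f2 = "euler_prod oo fps_X ^ 2"
  define V where "V = psi_weighted * jacobi_cube"
  show "fps_nth (euler_prod ^ 5) 0 = 1"
    by (simp add: euler_prod_nth_0 fps_power_zeroth_eq_one)
  have "5 dvd (euler_prod ^ 5) ^ 5 - (euler_prod ^ 5 oo fps_X ^ 5)"
    using dvd_power_diff[OF euler_prod_power_5, of 5] by (simp flip: fps_compose_power)
  hence A: "5 dvd ?U * ((euler_prod ^ 5) ^ 5 - (euler_prod ^ 5 oo fps_X ^ 5))"
    by (rule dvd_mult)
  obtain K where K: "euler_prod ^ 5 - (euler_prod oo fps_X ^ 5) = 5 * K"
    using euler_prod_power_5 by (elim dvdE)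
  have "(euler_prod ^ 5 oo fps_X ^ 2) - (?f2 oo fps_X ^ 5) = (euler_prod ^ 5 - (euler_prod oo fps_X ^ 5)) oo fps_X ^ 2"
    by (simp add: fps_compose_sub_distrib fps_compose_fps_X_power_power)
  also have "\<dots> = 5 * (K oo fps_X ^ 2)"
    by (simp add: K fps_compose_mult_distrib)
  finally have "5 dvd (euler_prod ^ 5 oo fps_X ^ 2) - (?f2 oo fps_X ^ 5)" by simp
  from dvd_power_diff[OF this, of 4]
  have "5 dvd (euler_prod ^ 5 oo fps_X ^ 2) ^ 4 - (?f2 ^ 4 oo fps_X ^ 5)"
    by (simp flip: fps_compose_power)
  hence B: "5 dvd 64 * V * ((euler_prod ^ 5 oo fps_X ^ 2) ^ 4 - (?f2 ^ 4 oo fps_X ^ 5))"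
    by (rule dvd_mult)
  have "zero_mod_5_at_3_4 (V * (64 * ?f2 ^ 4 oo fps_X ^ 5))"
    unfolding V_def by (intro zero_mod_5_at_3_4_mult psi_weighted_jacobi_cube)
  moreover have "5 dvd ?U * (euler_prod ^ 5 oo fps_X ^ 5) - V * (64 * ?f2 ^ 4 oo fps_X ^ 5)"
  proof -
    have "?U * (euler_prod ^ 5 oo fps_X ^ 5) - V * (64 * ?f2 ^ 4 oo fps_X ^ 5) =
       64 * V * ((euler_prod ^ 5 oo fps_X ^ 2) ^ 4 - (?f2 ^ 4 oo fps_X ^ 5)) - 
       ?U * ((euler_prod ^ 5) ^ 5 - (euler_prod ^ 5 oo fps_X ^ 5))"
      unfolding right_diff_distrib SOME_bar_8n_7_euler_prod V_def 
      by (simp add: fps_compose_mult_distrib mult_ac)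
    thus ?thesis using A B by (simp only: dvd_diff)
  qed
  ultimately show "zero_mod_5_at_3_4 (?U * (euler_prod ^ 5 oo fps_X ^ 5))"
    by (rule zero_mod_5_at_3_4_cong)
qed

theorem theorem16:
  fixes n :: nat
  shows "[SOME_bar (40 * n + 31) = 0] (mod 5) \<and> [SOME_bar (40 * n + 39) = 0] (mod 5)"
proof -
  have "5 dvd SOME_bar (8 * m + 7)" if "m mod 5 \<in> {3, 4}" for m
    using SOME_bar_8n_7_mod_5 that by (auto simp: zero_mod_5_at_3_4_def)
  from this[of "5 * n + 3"] this[of "5 * n + 4"] show ?thesis
    by (simp add: cong_0_iff algebra_simps mod_simps)
qed

end
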